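(* Let $d\geq 2$ be an integer. For any positive integer $D$ and any $\delta>0$ there exists a positive integer $k_0=k_0(D,\delta)$ (depending also on $d$) such that for every ergodic probability preserving action $T:\mathbb{Z}^d\curvearrowright(X,\mu)$ and every measurable $A\subset X$ with $\mu(A)\geq\delta$, there exists an integer $1\leq k\leq k_0$ such that the following holds. For any $v_1,\ldots,v_d\in\mathbb{Z}^d$ with $$0<|\det(v_1,\ldots,v_d)|\leq D,$$ there exists some $\gamma\in\mathrm{SL}_d(\mathbb{Z})$ with $$\mu\big(A\cap T_{\gamma k v_1}A\cap\cdots\cap T_{\gamma k v_d}A\big)>0 .$$
   Context: A probability preserving action $T:\mathbb{Z}^d\curvearrowright(X,\mu)$ is a measurable action $v\mapsto T_v$ of $\mathbb{Z}^d$ on a probability space $(X,\mu)$ by measure-preserving transformations; $L^2(\mu)$ is assumed separable. $\det(v_1,\ldots,v_d)$ is the determinant of the $d\times d$ matrix with columns $v_1,\ldots,v_d$, and $\gamma k v_i$ denotes the matrix $\gamma$ applied to the vector $kv_i$. *)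

theory Defs
  imports "HOL-Analysis.Analysis" "HOL-Probability.Probability_Measure"
begin

locale pmp_action = prob_space M
  for M :: "'a measure" +
  fixes T :: "int ^ 'd \<Rightarrow> 'a \<Rightarrow> 'a"
  assumes action_zero: "x \<in> space M \<Longrightarrow> T 0 x = x"
    and action_add: "x \<in> space M \<Longrightarrow> T (u + v) x = T u (T v x)"
    and action_measurable: "T v \<in> measurable M M"
    and action_preserving: "distr M M (T v) = M"

(* On the invertible action T, invariance T_v B = B for all v is the same as
   invariance of all preimages. *)
locale ergodic_pmp_action = pmp_action +
  assumes ergodic: "B \<in> sets M \<Longrightarrow> (\<And>v. T v -` B \<inter> space M = B) \<Longrightarrow> prob B = 0 \<or> prob B = 1"

(* There is no type of complex L2 functions in the library, so separability is stated for
   square-integrable representatives, with the L2 distance as a pseudometric. *)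
definition square_integrable :: "'a measure \<Rightarrow> ('a \<Rightarrow> complex) \<Rightarrow> bool" where
  "square_integrable M f \<longleftrightarrow>
     f \<in> borel_measurable M \<and> integrable M (\<lambda>x. (norm (f x))\<^sup>2)"

definition separable_L2 :: "'a measure \<Rightarrow> bool" where
  "separable_L2 M \<longleftrightarrow>
     (\<exists>S. countable S \<and> (\<forall>g\<in>S. square_integrable M g) \<and>
        (\<forall>f. square_integrable M f \<longrightarrow>
          (\<forall>\<epsilon>>0. \<exists>g\<in>S. sqrt (\<integral>x. (norm (f x - g x))\<^sup>2 \<partial>M) < \<epsilon>)))"

definition column_matrix :: "('d \<Rightarrow> int ^ 'd) \<Rightarrow> int ^ 'd ^ 'd" where
  "column_matrix v = (\<chi> r c. v c $ r)"

(* K has the property required of k0 for all systems whose underlying set lives in the type 'a. *)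
definition recurrence_bound :: "'a itself \<Rightarrow> 'd::finite itself \<Rightarrow> nat \<Rightarrow> real \<Rightarrow> nat \<Rightarrow> bool" where
  "recurrence_bound _ _ D \<delta> K \<longleftrightarrow>
     (\<forall>(M :: 'a measure) (T :: int ^ 'd \<Rightarrow> 'a \<Rightarrow> 'a) A.
        ergodic_pmp_action M T \<longrightarrow> separable_L2 M \<longrightarrow> A \<in> sets M \<longrightarrow> \<delta> \<le> measure M A \<longrightarrow>
        (\<exists>k::nat. 1 \<le> k \<and> k \<le> K \<and>
          (\<forall>v :: 'd \<Rightarrow> int ^ 'd.
             0 < \<bar>det (column_matrix v)\<bar> \<longrightarrow> \<bar>det (column_matrix v)\<bar> \<le> int D \<longrightarrow>
             (\<exists>\<gamma> :: int ^ 'd ^ 'd. det \<gamma> = 1 \<and>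
                measure M (A \<inter> (\<Inter>i. T (\<gamma> *v (int k *s v i)) ` A)) > 0))))"

(* HOL cannot quantify over types inside a formula, so a statement of the form
   "there is K with recurrence_bound TYPE('a) TYPE('d) D \<delta> K" would let K depend on the
   type 'a of the points of X. To obtain one constant for all systems, k0 is named by a term
   in which 'a does not occur: the least bound for systems on the configuration space
   {False, True}^(Z^d). (For every system and set A, the map sending x to the indicator of
   {v. T_v x \<in> A} is a factor map onto such a system.) *)
definition k0 :: "'d::finite itself \<Rightarrow> nat \<Rightarrow> real \<Rightarrow> nat" where
  "k0 d D \<delta> = (LEAST K. 0 < K \<and> recurrence_bound TYPE(int ^ 'd \<Rightarrow> bool) d D \<delta> K)"

end

theory Submission
  imports Defs "HOL-Library.Function_Algebras"
begin

text \<open>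
  Let \<open>f\<close> be the indicator of \<open>A\<close>. The measure to be bounded from below is the integral of \<open>f\<close> times the
  product of the translates of \<open>f\<close> by the vectors \<open>k b\<^sub>i\<close>, where \<open>b\<^sub>i = \<gamma> v\<^sub>i\<close>. The matrix \<open>\<gamma>\<close> is built as a
  product of shears in such a way that the translates can be exchanged, one after the other, for a
  single average \<open>g\<close> of \<open>f\<close> that is almost invariant under \<open>k \<int>\<^sup>d\<close>. What remains is the integral of
  \<open>f g\<^sup>d\<close>, which is almost the integral of \<open>g\<close> to the power \<open>d + 1\<close> and hence at least
  \<open>\<delta>\<^bsup>d+1\<^esup>\<close> up to a small error.

  The choice of \<open>k\<close>. Among the averages of \<open>f\<close> over translates by a sublattice \<open>\<Lambda>\<close>, those of almost minimal
  \<open>L\<^sup>2\<close> norm are almost \<open>\<Lambda>\<close>-invariant, by the parallelogram law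
  (\<open>near_minimiser_almost_invariant\<close>). Such averages stand in for the orthogonal projection onto the
  \<open>\<Lambda>\<close>-invariant functions; they are finite averages, so they commute and respect pointwise bounds. The minimal energies for \<open>L\<^sup>i \<int>\<^sup>d\<close> increase with \<open>i\<close> and stay below \<open>1\<close>,
  so among the first \<open>R\<close> values of \<open>i\<close> there is one where the energy hardly grows
  (\<open>energy_increment\<close>). There \<open>k = L\<^sup>i\<close> is chosen, and \<open>g\<close> is an almost minimal average over \<open>kL \<int>\<^sup>d\<close>:
  it is invariant under \<open>kL \<int>\<^sup>d\<close> up to an error that can be made as small as desired, and under \<open>k \<int>\<^sup>d\<close> up to \<open>\<epsilon>\<close>. Since
  \<open>L\<close> and \<open>R\<close> depend only on \<open>d\<close>, \<open>D\<close> and \<open>\<delta>\<close>, the bound \<open>L\<^sup>R\<close> for \<open>k\<close> is uniform.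

  Exchanging one translate. Let \<open>\<Delta>\<close> be the determinant of the frame. Adding \<open>\<Delta>\<close> times an integer combination
  of the other vectors to \<open>b\<^sub>j\<close> amounts to another choice of \<open>\<gamma>\<close> in \<open>SL\<^sub>d(\<int>)\<close>
  (\<open>sl_equivalent_shear\<close>). So \<open>k b\<^sub>j\<close> can be moved along the lattice spanned by the \<open>k\<Delta> b\<^sub>i\<close> with
  \<open>i \<noteq> j\<close>, and averaging over it replaces the translate of \<open>f\<close> by an average over a lattice of rank
  \<open>d - 1\<close>. As the index is infinite, that average may be far from \<open>g\<close>. However, adding
  \<open>c \<Delta> b\<^sub>j\<^sub>'\<close> to \<open>b\<^sub>j\<close> for \<open>c < J\<close> tilts the corresponding lattice of the index \<open>j'\<close> that is treated next,
  and any two of the tilted lattices together generate \<open>kL \<int>\<^sup>d\<close> or more. Therefore the parts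
  of the averages over these lattices that \<open>g\<close> does not see are almost orthogonal to each other, and by a Bessel inequality
  (\<open>bessel_inequality\<close>) all but few \<open>c\<close> give a lattice over which \<open>f\<close> averages to almost \<open>g\<close>. The exceptional \<open>c\<close>
  are too few to matter (\<open>correlation_step\<close>). A shear of \<open>b\<^sub>j\<close> leaves the other vectors alone, so the indices
  can be treated one by one (\<open>positive_correlation\<close>).

  Finally, \<open>k0\<close> is the least bound for systems on one particular point type. The map that sends a point \<open>x\<close> to
  its itinerary \<open>v \<mapsto> (T\<^sub>v x \<in> A)\<close> carries every system to one on that type and preserves
  all measures in question, so the bound holds for every system (\<open>recurrence_bound_transfer\<close>).
\<close>

section \<open>Averages along an action of an abelian group\<close>

text \<open>Observables are added and multiplied as elements of a ring, so products such as those in the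
  definition of \<open>weight\<close> below can be rearranged by ring laws. The pointwise unfoldings are therefore
  kept out of the simplifier and used only on demand.\<close>

declare plus_fun_apply [simp del] times_fun_apply [simp del] minus_apply [simp del]

lemmas pointwise = fun_eq_iff plus_fun_apply times_fun_apply minus_apply

lemma mean_close: "\<bar>a - c\<bar> \<le> e \<Longrightarrow> \<bar>b - c\<bar> \<le> e \<Longrightarrow> \<bar>(a + b) / 2 - c\<bar> \<le> e" for a b c e :: real
  by (simp add: abs_le_iff field_simps)

lemma le_mean_cases: "t \<le> (a + b) / 2 \<Longrightarrow> t \<le> a \<or> t \<le> b" for t a b :: real
  by (simp add: field_simps) linarith

text \<open>The action laws are required at every point of the type, not only on \<open>space M\<close>, so that the operators
  below satisfy their algebraic laws as equations between functions. An action on \<open>space M\<close> is brought into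
  this form by letting it fix all other points.\<close>
locale commuting_action = prob_space M
  for M :: "'a measure" +
  fixes T :: "'g::ab_group_add \<Rightarrow> 'a \<Rightarrow> 'a"
  assumes T_zero: "T 0 x = x"
    and T_add: "T (u + v) x = T u (T v x)"
    and T_measurable: "T v \<in> measurable M M"
    and T_preserving: "distr M M (T v) = M"
begin

text \<open>Bounded measurable functions form a ring on which the integral is defined everywhere, and \<open>L\<^sup>2\<close> geometry
  is available there without passing to classes of functions.\<close>
definition Obs :: "('a \<Rightarrow> real) set" where
  "Obs = {f \<in> borel_measurable M. \<exists>C. \<forall>x. \<bar>f x\<bar> \<le> C}"

definition translate :: "'g \<Rightarrow> ('a \<Rightarrow> real) \<Rightarrow> 'a \<Rightarrow> real" where
  "translate v f = (\<lambda>x. f (T v x))"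

definition halfway :: "('a \<Rightarrow> real) \<Rightarrow> ('a \<Rightarrow> real) \<Rightarrow> 'a \<Rightarrow> real" where
  "halfway f g = (\<lambda>x. (f x + g x) / 2)"

definition ip :: "('a \<Rightarrow> real) \<Rightarrow> ('a \<Rightarrow> real) \<Rightarrow> real" where
  "ip f g = expectation (f * g)"

definition nrm :: "('a \<Rightarrow> real) \<Rightarrow> real" where
  "nrm f = sqrt (ip f f)"

lemma Obs_add: "f \<in> Obs \<Longrightarrow> g \<in> Obs \<Longrightarrow> f + g \<in> Obs"
proof -
  assume f: "f \<in> Obs" and g: "g \<in> Obs"
  obtain C C' where C: "\<And>x. \<bar>f x\<bar> \<le> C" "\<And>x. \<bar>g x\<bar> \<le> C'"
    using f g unfolding Obs_def by blast
  have "\<bar>(f + g) x\<bar> \<le> C + C'" for x using C[of x] by (simp add: plus_fun_apply)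
  moreover have "f + g \<in> borel_measurable M"
    using f g unfolding Obs_def plus_fun_def by auto
  ultimately show ?thesis unfolding Obs_def by blast
qed

lemma Obs_mult: "f \<in> Obs \<Longrightarrow> g \<in> Obs \<Longrightarrow> f * g \<in> Obs"
proof -
  assume f: "f \<in> Obs" and g: "g \<in> Obs"
  obtain C C' where C: "\<And>x. \<bar>f x\<bar> \<le> C" "\<And>x. \<bar>g x\<bar> \<le> C'"
    using f g unfolding Obs_def by blast
  have "\<bar>(f * g) x\<bar> \<le> C * C'" for x
  proof -
    have "0 \<le> C" using C(1)[of x] by linarith
    then show ?thesis using C[of x] by (simp add: times_fun_apply abs_mult mult_mono)
  qed
  moreover have "f * g \<in> borel_measurable M"
    using f g unfolding Obs_def times_fun_def by auto
  ultimately show ?thesis unfolding Obs_def by blast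
qed

lemma Obs_const: "(\<lambda>_. c) \<in> Obs"
  unfolding Obs_def by auto

lemma Obs_one: "1 \<in> Obs"
  using Obs_const[of 1] by (simp add: one_fun_def)

lemma Obs_zero: "0 \<in> Obs"
  using Obs_const[of 0] by (simp add: zero_fun_def)

lemma Obs_diff: "f \<in> Obs \<Longrightarrow> g \<in> Obs \<Longrightarrow> f - g \<in> Obs"
proof -
  assume f: "f \<in> Obs" and g: "g \<in> Obs"
  have "f - g = f + (\<lambda>_. -1) * g" by (auto simp: pointwise)
  then show ?thesis using f g Obs_add Obs_mult Obs_const by metis
qed

lemma Obs_sum: "(\<And>i. i \<in> I \<Longrightarrow> f i \<in> Obs) \<Longrightarrow> sum f I \<in> Obs"
  by (induction I rule: infinite_finite_induct) (auto simp: Obs_zero Obs_add)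

lemma Obs_prod: "(\<And>i. i \<in> I \<Longrightarrow> f i \<in> Obs) \<Longrightarrow> prod f I \<in> Obs"
  by (induction I rule: infinite_finite_induct) (auto simp: Obs_one Obs_mult)

lemma Obs_power: "f \<in> Obs \<Longrightarrow> f ^ n \<in> Obs"
  by (induction n) (auto simp: Obs_one Obs_mult)

lemma Obs_translate: "f \<in> Obs \<Longrightarrow> translate v f \<in> Obs"
proof -
  assume f: "f \<in> Obs"
  have "(\<lambda>x. f (T v x)) \<in> borel_measurable M"
    using f T_measurable measurable_compose unfolding Obs_def by blast
  then show ?thesis using f unfolding Obs_def translate_def by auto
qed

lemma Obs_halfway: "f \<in> Obs \<Longrightarrow> g \<in> Obs \<Longrightarrow> halfway f g \<in> Obs"
proof -
  assume f: "f \<in> Obs" and g: "g \<in> Obs"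
  have "halfway f g = (\<lambda>_. 1/2) * (f + g)" by (auto simp: pointwise halfway_def)
  then show ?thesis using f g Obs_add Obs_mult Obs_const by metis
qed

lemmas Obs_intros = Obs_add Obs_mult Obs_const Obs_one Obs_zero Obs_diff Obs_sum Obs_prod
  Obs_power Obs_translate Obs_halfway

lemma Obs_integrable: "f \<in> Obs \<Longrightarrow> integrable M f"
proof -
  assume "f \<in> Obs"
  then obtain C where "f \<in> borel_measurable M" "\<And>x. \<bar>f x\<bar> \<le> C" unfolding Obs_def by blast
  then show ?thesis by (intro integrable_const_bound[of f C]) auto
qed

lemma expectation_translate: "f \<in> Obs \<Longrightarrow> expectation (translate v f) = expectation f"
proof -
  assume f: "f \<in> Obs"
  have "expectation f = integral\<^sup>L (distr M M (T v)) f" by (simp add: T_preserving)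
  also have "\<dots> = expectation (translate v f)"
    unfolding translate_def
    using f T_measurable by (intro integral_distr) (auto simp: Obs_def)
  finally show ?thesis ..
qed

lemma expectation_add: "f \<in> Obs \<Longrightarrow> g \<in> Obs \<Longrightarrow> expectation (f + g) = expectation f + expectation g"
  unfolding plus_fun_def by (rule Bochner_Integration.integral_add) (auto intro: Obs_integrable)

lemma expectation_diff: "f \<in> Obs \<Longrightarrow> g \<in> Obs \<Longrightarrow> expectation (f - g) = expectation f - expectation g"
  unfolding fun_diff_def by (rule Bochner_Integration.integral_diff) (auto intro: Obs_integrable)

lemma expectation_mono:
  "f \<in> Obs \<Longrightarrow> g \<in> Obs \<Longrightarrow> (\<And>x. f x \<le> g x) \<Longrightarrow> expectation f \<le> expectation g"
  by (rule integral_mono) (auto intro: Obs_integrable)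

lemma ip_commute: "ip f g = ip g f"
  unfolding ip_def by (simp add: mult.commute)

lemma ip_add_left:
  "f \<in> Obs \<Longrightarrow> g \<in> Obs \<Longrightarrow> h \<in> Obs \<Longrightarrow> ip (f + g) h = ip f h + ip g h"
  unfolding ip_def by (simp add: distrib_right expectation_add Obs_mult)

lemma ip_diff_left:
  "f \<in> Obs \<Longrightarrow> g \<in> Obs \<Longrightarrow> h \<in> Obs \<Longrightarrow> ip (f - g) h = ip f h - ip g h"
  unfolding ip_def by (simp add: left_diff_distrib expectation_diff Obs_mult)

lemma ip_add_right:
  "f \<in> Obs \<Longrightarrow> g \<in> Obs \<Longrightarrow> h \<in> Obs \<Longrightarrow> ip h (f + g) = ip h f + ip h g"
  using ip_add_left ip_commute by metis

lemma ip_diff_right: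
  "f \<in> Obs \<Longrightarrow> g \<in> Obs \<Longrightarrow> h \<in> Obs \<Longrightarrow> ip h (f - g) = ip h f - ip h g"
  using ip_diff_left ip_commute by metis

lemma ip_sum_left:
  "(\<And>i. i \<in> I \<Longrightarrow> f i \<in> Obs) \<Longrightarrow> h \<in> Obs \<Longrightarrow> ip (sum f I) h = (\<Sum>i\<in>I. ip (f i) h)"
proof (induction I rule: infinite_finite_induct)
  case (insert i I)
  then show ?case by (simp add: ip_add_left Obs_sum)
qed (simp_all add: ip_def zero_fun_def times_fun_def)

lemma ip_scale_left: "ip ((\<lambda>_. c) * f) g = c * ip f g"
proof -
  have *: "(\<lambda>_. c) * f * g = (\<lambda>x. c * (f * g) x)" by (auto simp: pointwise)
  show ?thesis unfolding ip_def * by simp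
qed

lemma ip_scale_right: "ip g ((\<lambda>_. c) * f) = c * ip g f"
  using ip_scale_left ip_commute by metis

lemma ip_halfway_left:
  assumes "f \<in> Obs" "g \<in> Obs" "h \<in> Obs"
  shows "ip (halfway f g) h = (ip f h + ip g h) / 2"
proof -
  have "halfway f g = (\<lambda>_. 1/2) * (f + g)" by (auto simp: pointwise halfway_def)
  then show ?thesis using assms by (simp add: ip_scale_left ip_add_left)
qed

lemma ip_halfway_right:
  assumes "f \<in> Obs" "g \<in> Obs" "h \<in> Obs"
  shows "ip h (halfway f g) = (ip h f + ip h g) / 2"
  using ip_halfway_left[OF assms] by (simp add: ip_commute)

lemma ip_self_nonneg: "0 \<le> ip f f"
  unfolding ip_def by (rule integral_nonneg_AE) (simp add: times_fun_apply)

lemma translate_mult: "translate v (f * g) = translate v f * translate v g"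
  and translate_diff: "translate v (f - g) = translate v f - translate v g"
  and translate_zero: "translate 0 f = f"
  and translate_translate: "translate u (translate v f) = translate (u + v) f"
  and translate_halfway: "translate v (halfway f g) = halfway (translate v f) (translate v g)"
  unfolding translate_def halfway_def
  using T_add[of v u] by (auto simp: pointwise T_zero add.commute)

lemma ip_translate:
  "f \<in> Obs \<Longrightarrow> g \<in> Obs \<Longrightarrow> ip (translate v f) (translate v g) = ip f g"
  unfolding ip_def translate_mult[symmetric] by (rule expectation_translate[OF Obs_mult])

lemma nrm_nonneg: "0 \<le> nrm f"
  unfolding nrm_def using ip_self_nonneg by simp

lemma nrm_square: "(nrm f)\<^sup>2 = ip f f"
  unfolding nrm_def using ip_self_nonneg by simp

lemma nrm_translate: "f \<in> Obs \<Longrightarrow> nrm (translate v f) = nrm f"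
  unfolding nrm_def by (simp add: ip_translate)

text \<open>The quadratic polynomial \<open>t \<mapsto> \<parallel>f - t g\<parallel>\<^sup>2\<close> is nonnegative.\<close>
lemma cauchy_schwarz:
  assumes f: "f \<in> Obs" and g: "g \<in> Obs"
  shows "\<bar>ip f g\<bar> \<le> nrm f * nrm g"
proof -
  let ?a = "ip f f" and ?b = "ip f g" and ?c = "ip g g"
  have q: "0 \<le> ?a - 2 * t * ?b + t\<^sup>2 * ?c" for t :: real
  proof -
    have s: "(\<lambda>_. t) * g \<in> Obs" using g by (intro Obs_intros)
    have "ip (f - (\<lambda>_. t) * g) (f - (\<lambda>_. t) * g)
        = ?a - ip f ((\<lambda>_. t) * g) - (ip ((\<lambda>_. t) * g) f - ip ((\<lambda>_. t) * g) ((\<lambda>_. t) * g))"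
      using f s by (simp add: ip_diff_left ip_diff_right Obs_diff)
    also have "\<dots> = ?a - 2 * t * ?b + t\<^sup>2 * ?c"
      by (simp add: ip_scale_left ip_scale_right ip_commute[of g f] power2_eq_square)
    finally show ?thesis using ip_self_nonneg by metis
  qed
  have "?b\<^sup>2 \<le> ?a * ?c"
  proof (cases "?c = 0")
    case True
    have "?b = 0"
    proof (rule ccontr)
      assume "?b \<noteq> 0"
      then show False using q[of "(?a + 1) / (2 * ?b)"] True by (simp add: field_simps)
    qed
    then show ?thesis using True by simp
  next
    case False
    then have "?c > 0" using ip_self_nonneg[of g] by simp
    then show ?thesis using q[of "?b / ?c"]
      by (simp add: field_simps power2_eq_square)
  qed
  then have "?b\<^sup>2 \<le> (nrm f * nrm g)\<^sup>2" by (simp add: power_mult_distrib nrm_square)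
  then show ?thesis
    using nrm_nonneg by (metis abs_le_square_iff abs_of_nonneg mult_nonneg_nonneg)
qed

lemma nrm_triangle:
  assumes f: "f \<in> Obs" and g: "g \<in> Obs"
  shows "nrm (f + g) \<le> nrm f + nrm g"
proof (rule power2_le_imp_le)
  have "(nrm (f + g))\<^sup>2 = ip f f + 2 * ip f g + ip g g"
    using f g by (simp add: nrm_square ip_add_left ip_add_right Obs_add ip_commute[of g f])
  also have "\<dots> \<le> (nrm f + nrm g)\<^sup>2"
    using cauchy_schwarz[OF f g] nrm_square[of f] nrm_square[of g] by (simp add: power2_sum)
  finally show "(nrm (f + g))\<^sup>2 \<le> (nrm f + nrm g)\<^sup>2" .
qed (simp add: nrm_nonneg)

lemma nrm_minus_commute: "nrm (f - g) = nrm (g - f)"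
proof -
  have "(f - g) * (f - g) = (g - f) * (g - f)" by (simp add: algebra_simps)
  then show ?thesis unfolding nrm_def ip_def by simp
qed

lemma nrm_diff_le:
  assumes f: "f \<in> Obs" and g: "g \<in> Obs"
  shows "nrm (f - g) \<le> nrm f + nrm g"
proof -
  have m: "0 - g \<in> Obs" using g by (intro Obs_intros)
  have "nrm (0 - g) = nrm g" using nrm_minus_commute[of 0 g] by simp
  moreover have "f - g = f + (0 - g)" by simp
  ultimately show ?thesis using nrm_triangle[OF f m] by metis
qed

lemma nrm_diff_triangle:
  assumes "f \<in> Obs" "g \<in> Obs" "h \<in> Obs"
  shows "nrm (f - h) \<le> nrm (f - g) + nrm (g - h)"
proof -
  have "f - h = (f - g) + (g - h)" by simp
  then show ?thesis using nrm_triangle[of "f - g" "g - h"] assms Obs_diff by metis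
qed

lemma nrm_halfway_le:
  assumes "f \<in> Obs" "g \<in> Obs" "nrm f \<le> e" "nrm g \<le> e"
  shows "nrm (halfway f g) \<le> e"
proof -
  let ?h = "(\<lambda>_. 1/2) :: 'a \<Rightarrow> real"
  have half: "nrm (?h * u) = nrm u / 2" for u
    unfolding nrm_def by (simp add: ip_scale_left ip_scale_right real_sqrt_divide)
  have "halfway f g = ?h * f + ?h * g"
    by (auto simp: pointwise halfway_def field_simps)
  moreover have "nrm (?h * f + ?h * g) \<le> nrm f / 2 + nrm g / 2"
    using nrm_triangle[of "?h * f" "?h * g"] assms(1,2) by (simp add: half Obs_mult Obs_const)
  ultimately show ?thesis using assms(3,4) by simp
qed

lemma nrm_le_one:
  assumes f: "f \<in> Obs" and b: "\<And>x. \<bar>f x\<bar> \<le> 1"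
  shows "nrm f \<le> 1"
proof -
  have "ip f f \<le> expectation (\<lambda>_. 1)"
    unfolding ip_def
  proof (rule expectation_mono)
    show "(f * f) x \<le> 1" for x
      using b[of x] abs_le_square_iff[of "f x" 1] by (simp add: power2_eq_square times_fun_apply)
  qed (use f in \<open>auto intro: Obs_intros\<close>)
  then show ?thesis unfolding nrm_def by (simp add: prob_space)
qed

lemma nrm_le_scaled:
  assumes u: "u \<in> Obs" and v: "v \<in> Obs" and le: "\<And>x. \<bar>u x\<bar> \<le> a * \<bar>v x\<bar>" and a: "0 \<le> a"
  shows "nrm u \<le> a * nrm v"
proof (rule power2_le_imp_le)
  have "ip u u \<le> expectation ((\<lambda>_. a) * v * ((\<lambda>_. a) * v))"
    unfolding ip_def
  proof (rule expectation_mono)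
    show "(u * u) x \<le> ((\<lambda>_. a) * v * ((\<lambda>_. a) * v)) x" for x
      using power_mono[OF le[of x], of 2]
      by (simp add: times_fun_apply power2_eq_square abs_mult_self mult_ac)
  qed (use u v in \<open>auto intro: Obs_intros\<close>)
  also have "\<dots> = a * (a * ip v v)"
    using ip_scale_left[of a v "(\<lambda>_. a) * v"] by (simp add: ip_def ip_scale_right[unfolded ip_def])
  also have "\<dots> = (a * nrm v)\<^sup>2" by (simp add: power_mult_distrib nrm_square) (simp add: power2_eq_square)
  finally show "(nrm u)\<^sup>2 \<le> (a * nrm v)\<^sup>2" by (simp add: nrm_square)
qed (simp add: a nrm_nonneg)

text \<open>The operators built from translates by elements of \<open>H\<close> by repeatedly taking midpoints, that is, averages with
  dyadic weights. Midpoints are all that the parallelogram law uses, and every estimate for averages follows from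
  the one for translates by induction.\<close>
inductive averaging :: "'g set \<Rightarrow> (('a \<Rightarrow> real) \<Rightarrow> 'a \<Rightarrow> real) \<Rightarrow> bool" for H where
  averaging_translate: "h \<in> H \<Longrightarrow> averaging H (translate h)"
| averaging_halfway: "averaging H \<Phi> \<Longrightarrow> averaging H \<Psi> \<Longrightarrow> averaging H (\<lambda>f. halfway (\<Phi> f) (\<Psi> f))"

lemma averaging_mono: "averaging H \<Phi> \<Longrightarrow> H \<subseteq> H' \<Longrightarrow> averaging H' \<Phi>"
  by (induction rule: averaging.induct)
     (simp_all add: averaging_translate subset_iff averaging_halfway)

lemma averaging_Obs: "averaging H \<Phi> \<Longrightarrow> f \<in> Obs \<Longrightarrow> \<Phi> f \<in> Obs"
  by (induction rule: averaging.induct) (simp_all add: Obs_translate Obs_halfway)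

lemma averaging_diff: "averaging H \<Phi> \<Longrightarrow> \<Phi> (f - g) = \<Phi> f - \<Phi> g"
  by (induction rule: averaging.induct)
     (simp_all only: translate_diff, simp add: halfway_def pointwise diff_divide_distrib add_divide_distrib)

lemma averaging_apply_halfway:
  "averaging H \<Phi> \<Longrightarrow> \<Phi> (halfway f g) = halfway (\<Phi> f) (\<Phi> g)"
  by (induction rule: averaging.induct)
     (simp_all only: translate_halfway, simp add: halfway_def add_divide_distrib add_ac)

lemma averaging_commute_translate:
  "averaging H \<Phi> \<Longrightarrow> \<Phi> (translate v f) = translate v (\<Phi> f)"
  by (induction rule: averaging.induct)
     (auto simp: translate_halfway translate_translate add.commute)

lemma averaging_commute:
  assumes "averaging H \<Phi>" and \<Psi>: "averaging H' \<Psi>"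
  shows "\<Phi> (\<Psi> f) = \<Psi> (\<Phi> f)"
  using assms(1)
proof (induction rule: averaging.induct)
  case (averaging_translate h)
  show ?case by (rule averaging_commute_translate[OF \<Psi>, symmetric])
next
  case (averaging_halfway \<Phi>\<^sub>1 \<Phi>\<^sub>2)
  then show ?case by (simp only: averaging_apply_halfway[OF \<Psi>])
qed

lemma averaging_translate_comp:
  assumes "averaging H \<Phi>" "h \<in> H" "\<And>u v. u \<in> H \<Longrightarrow> v \<in> H \<Longrightarrow> u + v \<in> H"
  shows "averaging H (\<lambda>f. translate h (\<Phi> f))"
  using assms(1)
proof (induction rule: averaging.induct)
  case (averaging_translate u)
  have "(\<lambda>f. translate h (translate u f)) = translate (h + u)"
    by (auto simp: translate_translate)
  then show ?case using assms averaging_translate averaging.averaging_translate by metis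
next
  case (averaging_halfway \<Phi> \<Psi>)
  then show ?case by (simp add: translate_halfway averaging.averaging_halfway)
qed

lemma averaging_bounds:
  assumes "averaging H \<Phi>" "\<And>x. 0 \<le> f x" "\<And>x. f x \<le> 1"
  shows "0 \<le> \<Phi> f x \<and> \<Phi> f x \<le> 1"
  using assms(1)
proof (induction arbitrary: x rule: averaging.induct)
  case (averaging_halfway \<Phi> \<Psi>)
  have "0 \<le> \<Phi> f x" "\<Phi> f x \<le> 1" "0 \<le> \<Psi> f x" "\<Psi> f x \<le> 1"
    using averaging_halfway.IH by auto
  then show ?case unfolding halfway_def by simp
qed (auto simp: translate_def assms)

lemma averaging_nrm_le:
  assumes "averaging H \<Phi>" "f \<in> Obs"
  shows "nrm (\<Phi> f) \<le> nrm f"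
  using assms(1)
proof (induction rule: averaging.induct)
  case (averaging_halfway \<Phi> \<Psi>)
  then show ?case
    using averaging_Obs[OF averaging_halfway.hyps(1) assms(2)]
      averaging_Obs[OF averaging_halfway.hyps(2) assms(2)] by (simp add: nrm_halfway_le)
qed (simp add: nrm_translate assms)

lemma averaging_almost_fixed:
  assumes "averaging H \<Phi>" "y \<in> Obs" "\<And>h. h \<in> H \<Longrightarrow> nrm (translate h y - y) \<le> e"
  shows "nrm (\<Phi> y - y) \<le> e"
  using assms(1)
proof (induction rule: averaging.induct)
  case (averaging_halfway \<Phi> \<Psi>)
  have "halfway (\<Phi> y) (\<Psi> y) - y = halfway (\<Phi> y - y) (\<Psi> y - y)"
    by (auto simp: halfway_def pointwise field_simps)
  then show ?case
    using averaging_halfway.IH averaging_Obs[OF averaging_halfway.hyps(1) assms(2)]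
      averaging_Obs[OF averaging_halfway.hyps(2) assms(2)] assms(2)
    by (simp add: nrm_halfway_le Obs_diff)
qed (use assms in auto)

lemma averaging_ip_close:
  assumes "averaging H \<Phi>" "y \<in> Obs" "z \<in> Obs"
    "\<And>h. h \<in> H \<Longrightarrow> \<bar>ip (translate h y) z - c\<bar> \<le> e"
  shows "\<bar>ip (\<Phi> y) z - c\<bar> \<le> e"
  using assms(1)
proof (induction rule: averaging.induct)
  case (averaging_halfway \<Phi> \<Psi>)
  have "ip (halfway (\<Phi> y) (\<Psi> y)) z = (ip (\<Phi> y) z + ip (\<Psi> y) z) / 2"
    using averaging_Obs[OF averaging_halfway.hyps(1) assms(2)]
      averaging_Obs[OF averaging_halfway.hyps(2) assms(2)] assms(3) by (rule ip_halfway_left)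
  then show ?case using mean_close[OF averaging_halfway.IH] by (simp only:)
qed (use assms in auto)

lemma averaging_expectation:
  assumes "averaging H \<Phi>" "f \<in> Obs"
  shows "expectation (\<Phi> f) = expectation f"
proof -
  have "\<bar>ip (\<Phi> f) 1 - expectation f\<bar> \<le> 0"
    using assms(2) Obs_one
    by (rule averaging_ip_close[OF assms(1)]) (simp add: ip_def expectation_translate assms(2))
  then show ?thesis by (simp add: ip_def)
qed

text \<open>An average of numbers is attained or exceeded by one of them. The sum over \<open>C\<close> makes the same
  translate serve several functions at once.\<close>
lemma averaging_ip_sum_ge:
  assumes "averaging H \<Phi>" "\<And>c. c \<in> C \<Longrightarrow> y c \<in> Obs" "\<And>c. c \<in> C \<Longrightarrow> z c \<in> Obs"
    "t \<le> (\<Sum>c\<in>C. ip (\<Phi> (y c)) (z c))"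
  shows "\<exists>h\<in>H. t \<le> (\<Sum>c\<in>C. ip (translate h (y c)) (z c))"
  using assms(1,4)
proof (induction rule: averaging.induct)
  case (averaging_halfway \<Phi> \<Psi>)
  have "(\<Sum>c\<in>C. ip (halfway (\<Phi> (y c)) (\<Psi> (y c))) (z c))
      = (\<Sum>c\<in>C. (ip (\<Phi> (y c)) (z c) + ip (\<Psi> (y c)) (z c)) / 2)"
    using assms(2,3) averaging_Obs[OF averaging_halfway.hyps(1)] averaging_Obs[OF averaging_halfway.hyps(2)]
    by (intro sum.cong ip_halfway_left) auto
  also have "\<dots> = ((\<Sum>c\<in>C. ip (\<Phi> (y c)) (z c)) + (\<Sum>c\<in>C. ip (\<Psi> (y c)) (z c))) / 2"
    by (simp add: sum.distrib flip: sum_divide_distrib)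
  finally have "t \<le> (\<Sum>c\<in>C. ip (\<Phi> (y c)) (z c)) \<or> t \<le> (\<Sum>c\<in>C. ip (\<Psi> (y c)) (z c))"
    using averaging_halfway.prems by (intro le_mean_cases) (simp only:)
  then show ?case using averaging_halfway.IH by blast
qed auto

text \<open>For a subgroup \<open>H\<close> this is the squared norm of the orthogonal projection of \<open>f\<close> onto the \<open>H\<close>-invariant functions, by the mean ergodic
  theorem.\<close>
definition min_energy :: "'g set \<Rightarrow> ('a \<Rightarrow> real) \<Rightarrow> real" where
  "min_energy H f = (INF \<Phi>\<in>{\<Phi>. averaging H \<Phi>}. (nrm (\<Phi> f))\<^sup>2)"

lemma min_energy_le: "averaging H \<Phi> \<Longrightarrow> min_energy H f \<le> (nrm (\<Phi> f))\<^sup>2"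
  unfolding min_energy_def by (rule cINF_lower) (auto intro!: bdd_belowI2[where m = 0])

lemma min_energy_approx:
  assumes "0 \<in> H" "e > 0"
  obtains \<Phi> where "averaging H \<Phi>" "(nrm (\<Phi> f))\<^sup>2 \<le> min_energy H f + e"
proof -
  have "{\<Phi>. averaging H \<Phi>} \<noteq> {}" using assms averaging_translate by blast
  then have "\<exists>\<Phi>\<in>{\<Phi>. averaging H \<Phi>}. (nrm (\<Phi> f))\<^sup>2 < min_energy H f + e"
    unfolding min_energy_def using assms
    by (subst cINF_less_iff[symmetric]) (auto intro!: bdd_belowI2[where m = 0])
  then show ?thesis using that by force
qed

lemma min_energy_nonneg: "0 \<in> H \<Longrightarrow> 0 \<le> min_energy H f"
  unfolding min_energy_def using averaging_translate by (intro cINF_greatest) auto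

lemma min_energy_le_square:
  assumes "0 \<in> H"
  shows "min_energy H f \<le> (nrm f)\<^sup>2"
  using min_energy_le[OF averaging_translate[OF assms], of f] by (simp add: translate_zero)

text \<open>The midpoint of \<open>\<Phi> f\<close> and its translate is again an average over \<open>H\<close>, so its energy is at least
  \<open>min_energy H f\<close>. Both ends have almost this energy, and the parallelogram law forces them to be close. The bound is the
  same for all \<open>h \<in> H\<close>.\<close>
lemma near_minimiser_almost_invariant:
  assumes \<Phi>: "averaging H \<Phi>" and f: "f \<in> Obs" and h: "h \<in> H"
    and H: "\<And>u v. u \<in> H \<Longrightarrow> v \<in> H \<Longrightarrow> u + v \<in> H"
    and le: "(nrm (\<Phi> f))\<^sup>2 \<le> min_energy H f + (e / 2)\<^sup>2" and e: "e \<ge> 0"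
  shows "nrm (translate h (\<Phi> f) - \<Phi> f) \<le> e"
proof (rule power2_le_imp_le)
  let ?a = "translate h (\<Phi> f)" and ?b = "\<Phi> f"
  have ab: "?a \<in> Obs" "?b \<in> Obs" using averaging_Obs[OF \<Phi> f] by (auto intro: Obs_translate)
  have "averaging H (\<lambda>f. halfway (translate h (\<Phi> f)) (\<Phi> f))"
    by (rule averaging_halfway[OF averaging_translate_comp[OF \<Phi> h H] \<Phi>])
  then have m: "min_energy H f \<le> (nrm (halfway ?a ?b))\<^sup>2" by (rule min_energy_le)
  have "(nrm (?a - ?b))\<^sup>2 = 2 * (nrm ?a)\<^sup>2 + 2 * (nrm ?b)\<^sup>2 - 4 * (nrm (halfway ?a ?b))\<^sup>2"
    unfolding nrm_square using ab
    by (simp add: ip_diff_left ip_diff_right ip_halfway_left ip_halfway_right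
        Obs_diff Obs_halfway ip_commute[of ?b ?a] add_divide_distrib)
  also have "\<dots> = 4 * (nrm ?b)\<^sup>2 - 4 * (nrm (halfway ?a ?b))\<^sup>2"
    using ab by (simp add: nrm_translate)
  also have "\<dots> \<le> e\<^sup>2" using m le by (simp add: power_divide)
  finally show "(nrm (?a - ?b))\<^sup>2 \<le> e\<^sup>2" .
qed (rule e)

end

section \<open>Almost invariant averages: energy increment and a Bessel inequality\<close>

context commuting_action
begin

text \<open>The energies \<open>min_energy (H i) f\<close> lie between \<open>0\<close> and \<open>1\<close>, so they cannot grow by more than \<open>\<epsilon>\<^sup>2 / 8\<close> in each of \<open>R\<close>
  steps. At a step without such growth an almost minimal average over the smaller set \<open>H (Suc i)\<close> is almost
  minimal over \<open>H i\<close> as well, hence almost invariant under both. The index \<open>i\<close> is chosen before \<open>\<eta>\<close>.\<close>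
lemma energy_increment:
  fixes H :: "nat \<Rightarrow> 'g set"
  assumes zero: "\<And>i. 0 \<in> H i" and add: "\<And>i u v. u \<in> H i \<Longrightarrow> v \<in> H i \<Longrightarrow> u + v \<in> H i"
    and dec: "\<And>i. H (Suc i) \<subseteq> H i"
    and f: "f \<in> Obs" "nrm f \<le> 1" and \<epsilon>: "\<epsilon> > 0" and R: "8 \<le> real R * \<epsilon>\<^sup>2"
  shows "\<exists>i<R. \<forall>\<eta>>0. \<exists>\<Phi>. averaging (H (Suc i)) \<Phi> \<and>
    (\<forall>h\<in>H (Suc i). nrm (translate h (\<Phi> f) - \<Phi> f) \<le> \<eta>) \<and>
    (\<forall>h\<in>H i. nrm (translate h (\<Phi> f) - \<Phi> f) \<le> \<epsilon>)"
proof -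
  have "\<exists>i<R. min_energy (H (Suc i)) f \<le> min_energy (H i) f + \<epsilon>\<^sup>2 / 8"
  proof (rule ccontr)
    assume "\<not> ?thesis"
    then have step: "min_energy (H (Suc i)) f > min_energy (H i) f + \<epsilon>\<^sup>2 / 8" if "i < R" for i
      using that by auto
    have "n \<le> R \<Longrightarrow> real n * (\<epsilon>\<^sup>2 / 8) \<le> min_energy (H n) f \<and>
        (n > 0 \<longrightarrow> real n * (\<epsilon>\<^sup>2 / 8) < min_energy (H n) f)" for n
    proof (induction n)
      case 0
      then show ?case by (simp add: min_energy_nonneg zero)
    next
      case (Suc n)
      then have "real n * (\<epsilon>\<^sup>2 / 8) \<le> min_energy (H n) f" by simp
      moreover have "min_energy (H n) f + \<epsilon>\<^sup>2 / 8 < min_energy (H (Suc n)) f"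
        using step[of n] Suc.prems by simp
      moreover have "real (Suc n) * (\<epsilon>\<^sup>2 / 8) = real n * (\<epsilon>\<^sup>2 / 8) + \<epsilon>\<^sup>2 / 8"
        by (simp add: field_simps)
      ultimately have "real (Suc n) * (\<epsilon>\<^sup>2 / 8) < min_energy (H (Suc n)) f" by linarith
      then show ?case by simp
    qed
    moreover have "R > 0" using R by (cases R) auto
    ultimately have "real R * (\<epsilon>\<^sup>2 / 8) < min_energy (H R) f" by blast
    moreover have "min_energy (H R) f \<le> 1"
      using min_energy_le_square[OF zero] f(2) nrm_nonneg[of f]
      by (meson order_trans power_le_one)
    ultimately show False using R by simp
  qed
  then obtain i where i: "i < R" "min_energy (H (Suc i)) f \<le> min_energy (H i) f + \<epsilon>\<^sup>2 / 8" by blast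
  have "\<exists>\<Phi>. averaging (H (Suc i)) \<Phi> \<and>
    (\<forall>h\<in>H (Suc i). nrm (translate h (\<Phi> f) - \<Phi> f) \<le> \<eta>) \<and>
    (\<forall>h\<in>H i. nrm (translate h (\<Phi> f) - \<Phi> f) \<le> \<epsilon>)" if \<eta>: "\<eta> > 0" for \<eta>
  proof -
    have "min ((\<eta> / 2)\<^sup>2) (\<epsilon>\<^sup>2 / 8) > 0" using \<eta> \<epsilon> by simp
    then obtain \<Phi> where \<Phi>: "averaging (H (Suc i)) \<Phi>"
      and le: "(nrm (\<Phi> f))\<^sup>2 \<le> min_energy (H (Suc i)) f + min ((\<eta> / 2)\<^sup>2) (\<epsilon>\<^sup>2 / 8)"
      using min_energy_approx[OF zero] by blast
    have a: "(nrm (\<Phi> f))\<^sup>2 \<le> min_energy (H (Suc i)) f + (\<eta> / 2)\<^sup>2"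
      using le min.cobounded1[of "(\<eta> / 2)\<^sup>2" "\<epsilon>\<^sup>2 / 8"] by linarith
    have b: "(nrm (\<Phi> f))\<^sup>2 \<le> min_energy (H i) f + (\<epsilon> / 2)\<^sup>2"
      using le i(2) min.cobounded2[of "(\<eta> / 2)\<^sup>2" "\<epsilon>\<^sup>2 / 8"] by (simp add: power_divide)
    show ?thesis
      using near_minimiser_almost_invariant[OF \<Phi> f(1) _ add a]
        near_minimiser_almost_invariant[OF averaging_mono[OF \<Phi> dec] f(1) _ add b] \<Phi> \<eta> \<epsilon>
      by (intro exI[of _ \<Phi>]) auto
  qed
  then show ?thesis using i(1) by blast
qed

end

text \<open>The average \<open>\<Gamma> f\<close> plays the role of the projection of \<open>f\<close> onto the \<open>\<Lambda>\<close>-invariant functions.\<close>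
locale almost_invariant_average = commuting_action M T
  for M :: "'a measure" and T :: "'g::ab_group_add \<Rightarrow> 'a \<Rightarrow> 'a" +
  fixes f :: "'a \<Rightarrow> real" and \<Gamma> :: "('a \<Rightarrow> real) \<Rightarrow> 'a \<Rightarrow> real" and \<Lambda> :: "'g set" and \<eta> :: real
  assumes f_Obs: "f \<in> Obs" and f_ge: "0 \<le> f x" and f_le: "f x \<le> 1"
    and \<Gamma>: "averaging \<Lambda> \<Gamma>"
    and fine_invariant: "h \<in> \<Lambda> \<Longrightarrow> nrm (translate h (\<Gamma> f) - \<Gamma> f) \<le> \<eta>"
begin

abbreviation "g \<equiv> \<Gamma> f"

lemma nrm_f_le: "nrm f \<le> 1"
  using f_ge f_le by (intro nrm_le_one f_Obs) (simp add: abs_le_iff order_trans[of "- _" 0])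

lemma g_Obs: "g \<in> Obs"
  by (rule averaging_Obs[OF \<Gamma> f_Obs])

lemma g_bounds: "0 \<le> g x" "g x \<le> 1"
  using averaging_bounds[OF \<Gamma>, of f x] f_ge f_le by auto

text \<open>Let \<open>P\<^sub>c\<close> and \<open>Q\<close> be the projections onto the functions invariant under \<open>G c\<close> and \<open>\<Lambda>\<close>. If two of the
  groups together cover \<open>\<Lambda>\<close>, then \<open>P\<^sub>c P\<^sub>c\<^sub>'\<close> projects onto \<open>\<Lambda>\<close>-invariant functions, so the ranges of \<open>(1 - Q) P\<^sub>c\<close>
  are pairwise orthogonal and Bessel bounds the sum of the squared norms of the \<open>(1 - Q) P\<^sub>c f\<close> by \<open>\<parallel>f\<parallel>\<^sup>2 \<le> 1\<close>. Here
  the operators \<open>\<Phi> c\<close> and \<open>\<Gamma>\<close> replace the projections, at the price of errors that are multiples of \<open>\<eta>\<close>.\<close>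
lemma bessel_inequality:
  assumes C: "finite C" and small: "16 * (real (card C))\<^sup>2 * \<eta> \<le> 1"
    and \<Phi>: "\<And>c. c \<in> C \<Longrightarrow> averaging (G c) (\<Phi> c)"
    and inv: "\<And>c h. c \<in> C \<Longrightarrow> h \<in> G c \<Longrightarrow> nrm (translate h (\<Phi> c f) - \<Phi> c f) \<le> \<eta>"
    and spread: "\<And>c c' w. c \<in> C \<Longrightarrow> c' \<in> C \<Longrightarrow> c \<noteq> c' \<Longrightarrow> w \<in> \<Lambda> \<Longrightarrow>
      \<exists>h\<in>G c. \<exists>h'\<in>G c'. w = h - h'"
  shows "(\<Sum>c\<in>C. (nrm (\<Phi> c f - \<Gamma> (\<Phi> c f)))\<^sup>2) \<le> 2"
proof -
  define \<phi> where "\<phi> c = \<Phi> c f" for c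
  define z where "z c = \<Gamma> (\<phi> c)" for c
  define y where "y c = \<phi> c - z c" for c
  have \<phi>O: "\<phi> c \<in> Obs" if "c \<in> C" for c unfolding \<phi>_def using averaging_Obs[OF \<Phi>[OF that] f_Obs] .
  have zO: "z c \<in> Obs" if "c \<in> C" for c unfolding z_def using averaging_Obs[OF \<Gamma> \<phi>O[OF that]] .
  have yO: "y c \<in> Obs" if "c \<in> C" for c unfolding y_def using \<phi>O zO that by (auto intro: Obs_diff)
  have \<phi>1: "nrm (\<phi> c) \<le> 1" if "c \<in> C" for c
    unfolding \<phi>_def using averaging_nrm_le[OF \<Phi>[OF that] f_Obs] nrm_f_le by linarith
  have z1: "nrm (z c) \<le> 1" if "c \<in> C" for c
    unfolding z_def using averaging_nrm_le[OF \<Gamma> \<phi>O[OF that]] \<phi>1[OF that] by linarith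
  have y2: "nrm (y c) \<le> 2" if "c \<in> C" for c
    unfolding y_def using nrm_diff_le[OF \<phi>O zO] \<phi>1 z1 that by force
  have z_alt: "z c = \<Phi> c g" if "c \<in> C" for c
    unfolding z_def \<phi>_def by (rule averaging_commute[OF \<Gamma> \<Phi>[OF that]])
  have z_inv: "nrm (translate w (z c) - z c) \<le> \<eta>" if c: "c \<in> C" and w: "w \<in> \<Lambda>" for c w
  proof -
    have "nrm (translate w (z c) - z c) = nrm (\<Phi> c (translate w g - g))"
      using averaging_commute_translate[OF \<Phi>[OF c], of w g] averaging_diff[OF \<Phi>[OF c], of "translate w g" g]
      by (simp add: z_alt[OF c])
    also have "\<dots> \<le> nrm (translate w g - g)"
      by (rule averaging_nrm_le[OF \<Phi>[OF c]]) (intro Obs_diff Obs_translate g_Obs)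
    finally show ?thesis using fine_invariant[OF w] by linarith
  qed
  have y_inv: "nrm (translate h (y c) - y c) \<le> 2 * \<eta>" if c: "c \<in> C" and h: "h \<in> G c" for c h
  proof -
    define u where "u = translate h (\<phi> c) - \<phi> c"
    have uO: "u \<in> Obs" unfolding u_def using \<phi>O[OF c] by (intro Obs_diff Obs_translate)
    have "translate h (z c) - z c = \<Gamma> u"
      using averaging_commute_translate[OF \<Gamma>, of h "\<phi> c"] averaging_diff[OF \<Gamma>, of "translate h (\<phi> c)" "\<phi> c"]
      by (simp add: z_def u_def)
    then have "translate h (y c) - y c = u - \<Gamma> u"
      unfolding y_def u_def by (simp add: translate_diff algebra_simps)
    moreover have "nrm (u - \<Gamma> u) \<le> nrm u + nrm u"
      using nrm_diff_le[OF uO averaging_Obs[OF \<Gamma> uO]] averaging_nrm_le[OF \<Gamma> uO] by linarith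
    moreover have "nrm u \<le> \<eta>" unfolding u_def \<phi>_def by (rule inv[OF c h])
    ultimately show ?thesis by simp
  qed
  have ip_le: "\<bar>ip u v\<bar> \<le> a * b"
    if "u \<in> Obs" "v \<in> Obs" "nrm u \<le> a" "nrm v \<le> b" for u v a b
  proof -
    have "0 \<le> a" using that(3) nrm_nonneg[of u] by linarith
    then have "nrm u * nrm v \<le> a * b" using that nrm_nonneg by (intro mult_mono) auto
    then show ?thesis using cauchy_schwarz[OF that(1,2)] by linarith
  qed
  have \<eta>0: "0 \<le> \<eta>" if ne: "C \<noteq> {}"
  proof -
    obtain c where "c \<in> C" using ne by blast
    moreover have "\<exists>h. h \<in> G c" if "c \<in> C" for c
      using \<Phi>[OF that] by (induction rule: averaging.induct) auto
    ultimately show ?thesis using inv nrm_nonneg order_trans by blast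
  qed
  have cross: "\<bar>ip (y c) (y c')\<bar> \<le> 10 * \<eta>" if c: "c \<in> C" "c' \<in> C" "c \<noteq> c'" for c c'
  proof -
    \<comment> \<open>Translating by \<open>w = h - h'\<close> moves the first factor by \<open>h\<close> and the second by \<open>h'\<close>, which hardly changes either;
      averaging over \<open>w\<close> then turns the first factor into \<open>\<Gamma> (y c)\<close>, which is almost zero.\<close>
    have "\<bar>ip (translate w (y c)) (y c') - ip (y c) (y c')\<bar> \<le> 8 * \<eta>" if w: "w \<in> \<Lambda>" for w
    proof -
      obtain h h' where h: "h \<in> G c" "h' \<in> G c'" "w = h - h'" using spread c w by blast
      have tO: "translate h (y c) \<in> Obs" "translate h' (y c') \<in> Obs"
        using yO c by (auto intro: Obs_translate)
      have "translate h (y c) = translate h' (translate w (y c))"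
        using h(3) by (simp add: translate_translate)
      then have e: "ip (translate w (y c)) (y c') = ip (translate h (y c)) (translate h' (y c'))"
        using yO c by (simp add: ip_translate Obs_translate)
      have "ip (translate h (y c)) (translate h' (y c')) - ip (y c) (y c')
         = ip (translate h (y c) - y c) (translate h' (y c')) + ip (y c) (translate h' (y c') - y c')"
        using tO yO c by (simp add: ip_diff_left ip_diff_right)
      moreover have "\<bar>ip (translate h (y c) - y c) (translate h' (y c'))\<bar> \<le> (2 * \<eta>) * 2"
        using tO yO c h y_inv y2 by (intro ip_le) (auto intro: Obs_diff simp: nrm_translate)
      moreover have "\<bar>ip (y c) (translate h' (y c') - y c')\<bar> \<le> 2 * (2 * \<eta>)"
        using tO yO c h y_inv y2 by (intro ip_le) (auto intro: Obs_diff)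
      ultimately show ?thesis using e by linarith
    qed
    then have "\<bar>ip (\<Gamma> (y c)) (y c') - ip (y c) (y c')\<bar> \<le> 8 * \<eta>"
      by (rule averaging_ip_close[OF \<Gamma> yO[OF c(1)] yO[OF c(2)]])
    moreover have "\<bar>ip (\<Gamma> (y c)) (y c')\<bar> \<le> \<eta> * 2"
    proof (rule ip_le)
      have "\<Gamma> (y c) = z c - \<Gamma> (z c)" unfolding y_def z_def by (rule averaging_diff[OF \<Gamma>])
      then have "nrm (\<Gamma> (y c)) = nrm (\<Gamma> (z c) - z c)" by (simp only: nrm_minus_commute)
      also have "\<dots> \<le> \<eta>" using averaging_almost_fixed[OF \<Gamma> zO[OF c(1)]] z_inv[OF c(1)] by blast
      finally show "nrm (\<Gamma> (y c)) \<le> \<eta>" .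
    qed (use averaging_Obs[OF \<Gamma> yO[OF c(1)]] yO[OF c(2)] y2[OF c(2)] in simp_all)
    ultimately show ?thesis by linarith
  qed
  \<comment> \<open>For exact projections \<open>y c\<close> is an orthogonal projection of \<open>f\<close>, and the two sides agree.\<close>
  have diag: "ip (y c) (y c) - 3 * \<eta> \<le> ip (y c) f" if c: "c \<in> C" for c
  proof -
    have "\<bar>ip (translate h f) (y c) - ip f (y c)\<bar> \<le> 2 * \<eta>" if h: "h \<in> G c" for h
    proof -
      have "ip f (y c) = ip (translate h f) (translate h (y c))"
        using f_Obs yO[OF c] by (simp add: ip_translate)
      then have "ip (translate h f) (y c) - ip f (y c) = - ip (translate h f) (translate h (y c) - y c)"
        using f_Obs yO[OF c] by (simp add: ip_diff_right Obs_translate)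
      moreover have "\<bar>ip (translate h f) (translate h (y c) - y c)\<bar> \<le> 1 * (2 * \<eta>)"
        using f_Obs yO[OF c] y_inv[OF c h] nrm_f_le
        by (intro ip_le) (auto intro: Obs_diff Obs_translate simp: nrm_translate)
      ultimately show ?thesis by simp
    qed
    then have a: "\<bar>ip (\<phi> c) (y c) - ip f (y c)\<bar> \<le> 2 * \<eta>"
      unfolding \<phi>_def by (rule averaging_ip_close[OF \<Phi>[OF c] f_Obs yO[OF c]])
    have "\<bar>ip (translate w (\<phi> c)) (z c) - ip (\<phi> c) (z c)\<bar> \<le> \<eta>" if w: "w \<in> \<Lambda>" for w
    proof -
      have "ip (\<phi> c) (z c) = ip (translate w (\<phi> c)) (translate w (z c))"
        using \<phi>O[OF c] zO[OF c] by (simp add: ip_translate)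
      then have "ip (translate w (\<phi> c)) (z c) - ip (\<phi> c) (z c)
          = - ip (translate w (\<phi> c)) (translate w (z c) - z c)"
        using \<phi>O[OF c] zO[OF c] by (simp add: ip_diff_right Obs_translate)
      moreover have "\<bar>ip (translate w (\<phi> c)) (translate w (z c) - z c)\<bar> \<le> 1 * \<eta>"
        using \<phi>O[OF c] zO[OF c] z_inv[OF c w] \<phi>1[OF c]
        by (intro ip_le) (auto intro: Obs_diff Obs_translate simp: nrm_translate)
      ultimately show ?thesis by simp
    qed
    then have "\<bar>ip (\<Gamma> (\<phi> c)) (z c) - ip (\<phi> c) (z c)\<bar> \<le> \<eta>"
      by (rule averaging_ip_close[OF \<Gamma> \<phi>O[OF c] zO[OF c]])
    then have b: "\<bar>ip (z c) (z c) - ip (\<phi> c) (z c)\<bar> \<le> \<eta>" by (simp add: z_def)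
    have "ip (y c) (y c) = ip (\<phi> c) (y c) - ip (z c) (y c)"
      using ip_diff_left[OF \<phi>O[OF c] zO[OF c] yO[OF c]] by (simp only: y_def[symmetric])
    also have "ip (z c) (y c) = ip (z c) (\<phi> c) - ip (z c) (z c)"
      unfolding y_def by (rule ip_diff_right[OF \<phi>O[OF c] zO[OF c] zO[OF c]])
    finally have "ip (y c) (y c) = ip (\<phi> c) (y c) - (ip (z c) (\<phi> c) - ip (z c) (z c))" .
    then show ?thesis using a b by (simp add: ip_commute[of "z c" "\<phi> c"] ip_commute[of f] abs_le_iff)
  qed
  show ?thesis
  proof (cases "C = {}")
    case False
    define Y where "Y = sum y C"
    have YO: "Y \<in> Obs" unfolding Y_def by (rule Obs_sum[OF yO])
    have Yf: "ip Y u = (\<Sum>c\<in>C. ip (y c) u)" if "u \<in> Obs" for u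
      unfolding Y_def by (rule ip_sum_left[OF yO that])
    define E where "E = (\<Sum>c\<in>C. ip (y c) (y c))"
    define n where "n = real (card C)"
    have n1: "1 \<le> n" unfolding n_def using C False by (simp add: Suc_le_eq card_gt_0_iff)
    have "ip Y f \<ge> (\<Sum>c\<in>C. ip (y c) (y c) - 3 * \<eta>)"
      unfolding Yf[OF f_Obs] by (rule sum_mono) (rule diag)
    then have Yf_ge: "ip Y f \<ge> E - 3 * n * \<eta>"
      by (simp add: sum_subtractf E_def n_def)
    have row: "ip (y c) Y \<le> ip (y c) (y c) + 10 * n * \<eta>" if c: "c \<in> C" for c
    proof -
      have "ip (y c) Y = (\<Sum>c'\<in>C. ip (y c') (y c))"
        using Yf[OF yO[OF c]] by (simp add: ip_commute[of _ Y])
      also have "\<dots> = ip (y c) (y c) + (\<Sum>c'\<in>C - {c}. ip (y c') (y c))"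
        by (rule sum.remove[OF C c])
      also have "(\<Sum>c'\<in>C - {c}. ip (y c') (y c)) \<le> (\<Sum>c'\<in>C - {c}. 10 * \<eta>)"
      proof (rule sum_mono)
        show "ip (y c') (y c) \<le> 10 * \<eta>" if "c' \<in> C - {c}" for c'
          using cross[of c' c] that c by auto
      qed
      also have "\<dots> \<le> n * (10 * \<eta>)"
        using \<eta>0[OF False] by (simp add: n_def card_Diff_singleton_if mult_right_mono)
      finally show ?thesis by (simp add: algebra_simps)
    qed
    have "ip Y Y = (\<Sum>c\<in>C. ip (y c) Y)" by (rule Yf[OF YO])
    also have "\<dots> \<le> (\<Sum>c\<in>C. ip (y c) (y c) + 10 * n * \<eta>)" by (rule sum_mono) (rule row)
    also have "\<dots> = E + 10 * n\<^sup>2 * \<eta>" by (simp add: sum.distrib E_def n_def power2_eq_square)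
    finally have YY: "ip Y Y \<le> E + 10 * n\<^sup>2 * \<eta>" .
    \<comment> \<open>As in the usual proof of the Bessel inequality, expand the squared distance of \<open>f\<close> from the sum of its components.\<close>
    have "0 \<le> ip (f - Y) (f - Y)" by (rule ip_self_nonneg)
    also have "\<dots> = ip f f - 2 * ip Y f + ip Y Y"
      using f_Obs YO by (simp add: ip_diff_left ip_diff_right Obs_diff ip_commute[of f Y])
    also have "\<dots> \<le> 1 - 2 * (E - 3 * n * \<eta>) + (E + 10 * n\<^sup>2 * \<eta>)"
    proof -
      have "ip f f \<le> 1" using nrm_square[of f] nrm_f_le nrm_nonneg[of f] by (metis power_le_one)
      moreover have "2 * (E - 3 * n * \<eta>) \<le> 2 * ip Y f" using Yf_ge by (rule mult_left_mono) simp
      ultimately show ?thesis using YY by (intro add_mono diff_mono)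
    qed
    finally have "E \<le> 1 + 6 * (n * \<eta>) + 10 * (n\<^sup>2 * \<eta>)" by simp
    moreover have "n * \<eta> \<le> n\<^sup>2 * \<eta>"
      using n1 \<eta>0[OF False] by (simp add: power2_eq_square mult_right_mono)
    moreover have "16 * (n\<^sup>2 * \<eta>) \<le> 1" using small by (simp add: n_def)
    ultimately have "E \<le> 2" by linarith
    then show ?thesis by (simp add: E_def nrm_square y_def z_def \<phi>_def)
  qed simp
qed

definition approximates :: "real \<Rightarrow> 'g set \<Rightarrow> bool" where
  "approximates \<epsilon> H \<longleftrightarrow> (\<exists>\<Phi>. averaging H \<Phi> \<and> nrm (\<Phi> f - g) \<le> \<epsilon>)"

text \<open>Let \<open>\<phi>\<^sub>c\<close> be an almost minimal average over \<open>G c\<close>. As \<open>G c\<close> lies in \<open>K\<close> and \<open>g\<close> is almost \<open>K\<close>-invariant,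
  \<open>\<Gamma> \<phi>\<^sub>c = \<Phi>\<^sub>c g\<close> is within \<open>\<epsilon>\<close> of \<open>g\<close>. So \<open>\<phi>\<^sub>c\<close> can be far from \<open>g\<close> only if it is far from \<open>\<Gamma> \<phi>\<^sub>c\<close>, which the
  Bessel inequality allows for few \<open>c\<close>.\<close>
lemma few_not_approximating:
  assumes \<epsilon>: "\<epsilon> > 0" and coarse: "\<And>h. h \<in> K \<Longrightarrow> nrm (translate h g - g) \<le> \<epsilon>"
    and C: "finite C" and \<eta>: "\<eta> > 0" and small: "16 * (real (card C))\<^sup>2 * \<eta> \<le> 1"
    and G: "\<And>c. c \<in> C \<Longrightarrow> 0 \<in> G c" "\<And>c u v. c \<in> C \<Longrightarrow> u \<in> G c \<Longrightarrow> v \<in> G c \<Longrightarrow> u + v \<in> G c"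
      "\<And>c. c \<in> C \<Longrightarrow> G c \<subseteq> K"
    and spread: "\<And>c c' w. c \<in> C \<Longrightarrow> c' \<in> C \<Longrightarrow> c \<noteq> c' \<Longrightarrow> w \<in> \<Lambda> \<Longrightarrow>
      \<exists>h\<in>G c. \<exists>h'\<in>G c'. w = h - h'"
    and bad: "\<And>c. c \<in> C \<Longrightarrow> \<not> approximates (2 * \<epsilon>) (G c)"
  shows "real (card C) * \<epsilon>\<^sup>2 \<le> 2"
proof -
  have "\<exists>\<Phi>. averaging (G c) \<Phi> \<and> (\<forall>h\<in>G c. nrm (translate h (\<Phi> f) - \<Phi> f) \<le> \<eta>)" if c: "c \<in> C" for c
  proof -
    obtain \<Phi> where \<Phi>: "averaging (G c) \<Phi>" "(nrm (\<Phi> f))\<^sup>2 \<le> min_energy (G c) f + (\<eta> / 2)\<^sup>2"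
      using min_energy_approx[OF G(1)[OF c], of "(\<eta> / 2)\<^sup>2"] \<eta> by (metis half_gt_zero zero_less_power)
    then show ?thesis
      using near_minimiser_almost_invariant[OF \<Phi>(1) f_Obs _ G(2)[OF c] \<Phi>(2)] \<eta> by force
  qed
  then obtain \<Phi> where \<Phi>: "\<And>c. c \<in> C \<Longrightarrow> averaging (G c) (\<Phi> c)"
    and inv: "\<And>c h. c \<in> C \<Longrightarrow> h \<in> G c \<Longrightarrow> nrm (translate h (\<Phi> c f) - \<Phi> c f) \<le> \<eta>"
    by metis
  have ge: "\<epsilon>\<^sup>2 \<le> (nrm (\<Phi> c f - \<Gamma> (\<Phi> c f)))\<^sup>2" if c: "c \<in> C" for c
  proof -
    have O: "\<Phi> c f \<in> Obs" by (rule averaging_Obs[OF \<Phi>[OF c] f_Obs])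
    have "nrm (\<Gamma> (\<Phi> c f) - g) \<le> \<epsilon>"
      unfolding averaging_commute[OF \<Gamma> \<Phi>[OF c]]
      by (rule averaging_almost_fixed[OF \<Phi>[OF c] g_Obs]) (use coarse G(3)[OF c] in blast)
    moreover have "\<not> nrm (\<Phi> c f - g) \<le> 2 * \<epsilon>"
      using bad[OF c] \<Phi>[OF c] unfolding approximates_def by blast
    ultimately have "\<epsilon> \<le> nrm (\<Phi> c f - \<Gamma> (\<Phi> c f))"
      using nrm_diff_triangle[OF O averaging_Obs[OF \<Gamma> O] g_Obs] by linarith
    then show ?thesis using \<epsilon> by (simp add: power_mono)
  qed
  have "real (card C) * \<epsilon>\<^sup>2 = (\<Sum>c\<in>C. \<epsilon>\<^sup>2)" by simp
  also have "\<dots> \<le> (\<Sum>c\<in>C. (nrm (\<Phi> c f - \<Gamma> (\<Phi> c f)))\<^sup>2)" by (rule sum_mono) (rule ge)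
  also have "\<dots> \<le> 2" by (rule bessel_inequality[OF C small \<Phi> inv spread])
  finally show ?thesis .
qed

end

section \<open>Shears of integer frames\<close>

text \<open>By Cramer's rule these are the coordinates of \<open>x\<close> in the frame \<open>b\<close>, multiplied by the determinant of the
  frame; unlike the coordinates themselves they are integers. As functionals of \<open>x\<close> they are the rows of the
  adjugate matrix.\<close>
definition cramer_coordinate :: "('d::finite \<Rightarrow> int ^ 'd) \<Rightarrow> 'd \<Rightarrow> int ^ 'd \<Rightarrow> int" where
  "cramer_coordinate b j x = det (column_matrix (b(j := x)))"

lemma det_column_matrix: "det (column_matrix v) = det (\<chi> i. v i)"
proof -
  have "column_matrix v = transpose (\<chi> i. v i)"
    by (simp add: column_matrix_def transpose_def)
  then show ?thesis by (simp add: det_transpose)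
qed

lemma cramer_coordinate_rows: "cramer_coordinate b j x = det (\<chi> i. if i = j then x else b i)"
  unfolding cramer_coordinate_def det_column_matrix by (simp add: fun_upd_def)

lemma cramer_coordinate_add:
  "cramer_coordinate b j (x + y) = cramer_coordinate b j x + cramer_coordinate b j y"
  unfolding cramer_coordinate_rows using det_row_add[of j "\<lambda>_. x" "\<lambda>_. y" b] by simp

lemma cramer_coordinate_scale:
  "cramer_coordinate b j (c *s x) = c * cramer_coordinate b j x"
  unfolding cramer_coordinate_rows using det_row_mul[of j c "\<lambda>_. x" b] by simp

lemma cramer_coordinate_zero: "cramer_coordinate b j 0 = 0"
  using cramer_coordinate_scale[of b j 0 0] by simp

lemma cramer_coordinate_sum:
  "cramer_coordinate b j (\<Sum>i\<in>I. x i) = (\<Sum>i\<in>I. cramer_coordinate b j (x i))"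
  by (induction I rule: infinite_finite_induct)
     (simp_all add: cramer_coordinate_zero cramer_coordinate_add)

lemma cramer_coordinate_other: "i \<noteq> j \<Longrightarrow> cramer_coordinate b j (b i) = 0"
  unfolding cramer_coordinate_rows by (rule det_identical_rows[of i j]) (simp_all add: row_def)

lemma cramer_coordinate_same: "cramer_coordinate b j (b j) = det (column_matrix b)"
  unfolding cramer_coordinate_def by simp

lemma cramer_coordinate_axis_sum:
  "(\<Sum>s\<in>UNIV. cramer_coordinate b j (axis s 1) * x $ s) = cramer_coordinate b j x"
proof -
  have "cramer_coordinate b j (\<Sum>s\<in>UNIV. x $ s *s axis s 1)
      = (\<Sum>s\<in>UNIV. x $ s * cramer_coordinate b j (axis s 1))"
    by (simp only: cramer_coordinate_scale cramer_coordinate_sum)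
  then have "cramer_coordinate b j x = (\<Sum>s\<in>UNIV. x $ s * cramer_coordinate b j (axis s 1))"
    by (simp only: basis_expansion)
  then show ?thesis by (simp add: mult.commute)
qed

lemma det_of_int: "det (\<chi> i j. of_int (A $ i $ j)) = (of_int (det A) :: 'a::comm_ring_1)"
  unfolding det_def by (simp add: of_int_sum of_int_prod)

text \<open>Follows from Cramer's rule over the reals.\<close>
lemma cramer_identity:
  fixes b :: "'d::finite \<Rightarrow> int ^ 'd"
  assumes "det (column_matrix b) \<noteq> 0"
  shows "det (column_matrix b) *s x = (\<Sum>j\<in>UNIV. cramer_coordinate b j x *s b j)"
proof -
  define B :: "real ^ 'd ^ 'd" where "B = (\<chi> r c. of_int (column_matrix b $ r $ c))"
  define X :: "real ^ 'd" where "X = (\<chi> r. of_int (x $ r))"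
  have dB: "det B = of_int (det (column_matrix b))" unfolding B_def by (rule det_of_int)
  have dC: "det (\<chi> i j. if j = k then X $ i else B $ i $ j) = of_int (cramer_coordinate b k x)" for k
  proof -
    have "(\<chi> i j. if j = k then X $ i else B $ i $ j) = (\<chi> i j. of_int (column_matrix (b(k := x)) $ i $ j))"
      by (simp add: vec_eq_iff X_def B_def column_matrix_def)
    then show ?thesis by (simp add: det_of_int cramer_coordinate_def)
  qed
  have "B *v (\<chi> k. of_int (cramer_coordinate b k x) / det B) = X"
    using cramer[of B] dB assms by (simp add: dC)
  then have "(\<Sum>k\<in>UNIV. B $ r $ k * (of_int (cramer_coordinate b k x) / det B)) = X $ r" for r
    by (auto simp: matrix_vector_mult_def vec_eq_iff)
  then have "(\<Sum>k\<in>UNIV. B $ r $ k * of_int (cramer_coordinate b k x)) = det B * X $ r" for r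
    using dB assms by (simp add: field_simps flip: sum_divide_distrib)
  then have "(\<Sum>k\<in>UNIV. B $ r $ k * of_int (cramer_coordinate b k x))
      = of_int (det (column_matrix b)) * X $ r" for r
    by (simp only: dB)
  then have "of_int (\<Sum>k\<in>UNIV. b k $ r * cramer_coordinate b k x)
      = (of_int (det (column_matrix b) * x $ r) :: real)" for r
    by (simp add: B_def X_def column_matrix_def)
  then have "(\<Sum>k\<in>UNIV. b k $ r * cramer_coordinate b k x) = det (column_matrix b) * x $ r" for r
    using of_int_eq_iff by blast
  then show ?thesis by (simp add: vec_eq_iff mult.commute)
qed

definition sl_equivalent :: "('d::finite \<Rightarrow> int ^ 'd) \<Rightarrow> ('d \<Rightarrow> int ^ 'd) \<Rightarrow> bool" where
  "sl_equivalent v b \<longleftrightarrow> (\<exists>\<gamma> :: int ^ 'd ^ 'd. det \<gamma> = 1 \<and> (\<forall>i. b i = \<gamma> *v v i))"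

lemma det_column_matrix_mult:
  "det (column_matrix (\<lambda>i. \<gamma> *v v i)) = det \<gamma> * det (column_matrix v)"
proof -
  have "column_matrix (\<lambda>i. \<gamma> *v v i) = \<gamma> ** column_matrix v"
    by (simp add: vec_eq_iff column_matrix_def matrix_vector_mult_def matrix_matrix_mult_def)
  then show ?thesis by (simp add: det_mul)
qed

lemma sl_equivalent_det: "sl_equivalent v b \<Longrightarrow> det (column_matrix b) = det (column_matrix v)"
proof -
  assume "sl_equivalent v b"
  then obtain \<gamma> where \<gamma>: "det \<gamma> = 1" "\<And>i. b i = \<gamma> *v v i" unfolding sl_equivalent_def by blast
  then have "b = (\<lambda>i. \<gamma> *v v i)" by auto
  then show ?thesis using \<gamma>(1) by (simp add: det_column_matrix_mult)
qed

lemma sl_equivalent_refl: "sl_equivalent v v"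
  unfolding sl_equivalent_def by (intro exI[of _ "mat 1"]) simp

lemma matrix_vector_mult_scale: "\<gamma> *v (c *s x) = c *s (\<gamma> *v x)"
  for \<gamma> :: "int ^ 'd::finite ^ 'd"
  by (simp add: vec_eq_iff matrix_vector_mult_def sum_distrib_left mult.left_commute)

lemma matrix_vector_mult_sum_scale:
  fixes \<gamma> :: "int ^ 'd::finite ^ 'd"
  shows "\<gamma> *v (\<Sum>i\<in>I. n i *s v i) = (\<Sum>i\<in>I. n i *s (\<gamma> *v v i))"
  by (induction I rule: infinite_finite_induct)
     (simp_all add: matrix_vector_right_distrib matrix_vector_mult_scale)

text \<open>With \<open>w\<close> an integer combination of the \<open>v i\<close>, \<open>i \<noteq> j\<close>, the map \<open>U x = x + cramer_coordinate v j x *s w\<close> has integer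
  coefficients, adds \<open>\<Delta> *s w\<close> to \<open>v j\<close> and fixes the other vectors of \<open>v\<close>; this is where the factor \<open>\<Delta>\<close>
  comes from. The frames before and after the shear have the same nonzero determinant, so \<open>\<gamma> ** U\<close> has determinant \<open>1\<close>.\<close>
lemma sl_equivalent_shear:
  fixes v b :: "'d::finite \<Rightarrow> int ^ 'd"
  assumes eq: "sl_equivalent v b" and \<Delta>: "\<Delta> = det (column_matrix v)" "\<Delta> \<noteq> 0"
  shows "sl_equivalent v (b(j := b j + \<Delta> *s (\<Sum>i\<in>UNIV - {j}. n i *s b i)))"
proof -
  obtain \<gamma> :: "int ^ 'd ^ 'd" where \<gamma>: "det \<gamma> = 1" "\<And>i. b i = \<gamma> *v v i"
    using eq unfolding sl_equivalent_def by blast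
  define w where "w = (\<Sum>i\<in>UNIV - {j}. n i *s v i)"
  define b' where "b' = b(j := b j + \<Delta> *s (\<Sum>i\<in>UNIV - {j}. n i *s b i))"
  define U :: "int ^ 'd ^ 'd"
    where "U = (\<chi> r s. mat 1 $ r $ s + w $ r * cramer_coordinate v j (axis s 1))"
  have U: "U *v x = x + cramer_coordinate v j x *s w" for x
  proof -
    have "(U *v x) $ r = (x + cramer_coordinate v j x *s w) $ r" for r
    proof -
      have "(U *v x) $ r = (mat 1 *v x) $ r
          + w $ r * (\<Sum>s\<in>UNIV. cramer_coordinate v j (axis s 1) * x $ s)"
        by (simp add: U_def matrix_vector_mult_def distrib_right sum.distrib sum_distrib_left mult.assoc)
      then show ?thesis unfolding cramer_coordinate_axis_sum by (simp add: mult.commute)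
    qed
    then show ?thesis by (simp add: vec_eq_iff)
  qed
  have act: "b' i = (\<gamma> ** U) *v v i" for i
  proof (cases "i = j")
    case True
    have "\<gamma> *v (\<Delta> *s w) = \<Delta> *s (\<Sum>i\<in>UNIV - {j}. n i *s b i)"
      unfolding w_def using matrix_vector_mult_sum_scale[of \<gamma> n v]
      by (simp add: matrix_vector_mult_scale \<gamma>(2))
    then show ?thesis using True
      by (simp add: b'_def U \<gamma>(2) matrix_vector_mul_assoc[symmetric] matrix_vector_right_distrib
          cramer_coordinate_same \<Delta>(1))
  next
    case False
    then show ?thesis
      by (simp add: b'_def U \<gamma>(2) matrix_vector_mul_assoc[symmetric] cramer_coordinate_other)
  qed
  have "det (column_matrix b') = cramer_coordinate b j (b j + \<Delta> *s (\<Sum>i\<in>UNIV - {j}. n i *s b i))"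
    unfolding b'_def cramer_coordinate_def ..
  also have "\<dots> = det (column_matrix b)"
    by (simp add: cramer_coordinate_add cramer_coordinate_scale cramer_coordinate_sum
        cramer_coordinate_other cramer_coordinate_same)
  also have "\<dots> = \<Delta>" using sl_equivalent_det[OF eq] \<Delta> by simp
  finally have "det (column_matrix b') = \<Delta>" .
  moreover have "b' = (\<lambda>i. (\<gamma> ** U) *v v i)" using act by auto
  ultimately have "det (\<gamma> ** U) * \<Delta> = \<Delta>"
    using det_column_matrix_mult[of "\<gamma> ** U" v] \<Delta>(1) by simp
  then have "det (\<gamma> ** U) = 1" using \<Delta>(2) by simp
  then show ?thesis using act unfolding sl_equivalent_def b'_def by blast
qed

text \<open>With \<open>m = k \<Delta>\<close> this is the set of vectors by which shears move \<open>k b\<^sub>j\<close>.\<close>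
definition complementary_span :: "int \<Rightarrow> ('d::finite \<Rightarrow> int ^ 'd) \<Rightarrow> 'd \<Rightarrow> (int ^ 'd) set" where
  "complementary_span m b j = {m *s (\<Sum>i\<in>UNIV - {j}. n i *s b i) | n. True}"

lemma complementary_spanI: "m *s (\<Sum>i\<in>UNIV - {j}. n i *s b i) \<in> complementary_span m b j"
  unfolding complementary_span_def by blast

lemma zero_in_complementary_span: "0 \<in> complementary_span m b j"
  using complementary_spanI[of m "\<lambda>_. 0" b j] by simp

lemma add_in_complementary_span:
  "u \<in> complementary_span m b j \<Longrightarrow> v \<in> complementary_span m b j \<Longrightarrow> u + v \<in> complementary_span m b j"
proof -
  assume "u \<in> complementary_span m b j" "v \<in> complementary_span m b j"
  then obtain n n' where "u = m *s (\<Sum>i\<in>UNIV - {j}. n i *s b i)" "v = m *s (\<Sum>i\<in>UNIV - {j}. n' i *s b i)"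
    unfolding complementary_span_def by blast
  then have "u + v = m *s (\<Sum>i\<in>UNIV - {j}. (n i + n' i) *s b i)"
    by (simp add: vector_sadd_rdistrib sum.distrib vector_add_ldistrib)
  then show ?thesis using complementary_spanI by metis
qed

definition shear :: "int \<Rightarrow> ('d::finite \<Rightarrow> int ^ 'd) \<Rightarrow> 'd \<Rightarrow> 'd \<Rightarrow> int \<Rightarrow> 'd \<Rightarrow> int ^ 'd" where
  "shear \<Delta> b j j' c = b(j := b j + (\<Delta> * c) *s b j')"

lemma sum_single: "j' \<noteq> j \<Longrightarrow> (\<Sum>i\<in>UNIV - {j}. (if i = j' then c else 0) *s b i) = c *s b j'"
  for b :: "'d::finite \<Rightarrow> int ^ 'd"
proof -
  assume "j' \<noteq> j"
  have "(\<Sum>i\<in>UNIV - {j}. (if i = j' then c else 0) *s b i) = (\<Sum>i\<in>UNIV - {j}. if i = j' then c *s b i else 0)"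
    by (rule sum.cong) auto
  then show ?thesis using \<open>j' \<noteq> j\<close> by simp
qed

lemma sl_equivalent_shear_single:
  assumes "sl_equivalent v b" "\<Delta> = det (column_matrix v)" "\<Delta> \<noteq> 0" "j' \<noteq> j"
  shows "sl_equivalent v (shear \<Delta> b j j' c)"
proof -
  have "\<Delta> *s (\<Sum>i\<in>UNIV - {j}. (if i = j' then c else 0) *s b i) = (\<Delta> * c) *s b j'"
    by (simp add: sum_single[OF assms(4)])
  then show ?thesis
    using sl_equivalent_shear[OF assms(1-3), of j "\<lambda>i. if i = j' then c else 0"]
    unfolding shear_def by simp
qed

text \<open>Expand \<open>\<Delta> x\<close> in the frame \<open>E\<close>. All its terms except a multiple of \<open>e j'\<close> lie in the span complementary to
  \<open>j'\<close>. The missing direction is the difference of the two sheared vectors,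
  \<open>E j - E' j = \<Delta> (c - c') e j'\<close>, one of which lies in each span. Of the three factors \<open>\<Delta>\<close> in \<open>L\<close>, one
  is used for Cramer's rule, one for this difference and one for the scaling of the spans.\<close>
lemma complementary_spans_spread:
  fixes e :: "'d::finite \<Rightarrow> int ^ 'd"
  assumes det: "\<And>c. det (column_matrix (shear \<Delta> e j j' c)) = \<Delta>" and \<Delta>: "\<Delta> \<noteq> 0" and j: "j' \<noteq> j"
    and L: "\<Delta> ^ 3 * (c - c') dvd L"
  shows "\<exists>h\<in>complementary_span (k * \<Delta>) (shear \<Delta> e j j' c) j'.
    \<exists>h'\<in>complementary_span (k * \<Delta>) (shear \<Delta> e j j' c') j'. (k * L) *s x = h - h'"
proof -
  obtain q where q: "L = \<Delta> ^ 3 * (c - c') * q" using L by (elim dvdE)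
  define E where "E = shear \<Delta> e j j' c"
  define E' where "E' = shear \<Delta> e j j' c'"
  define lam where "lam i = cramer_coordinate E i x" for i
  define r where "r = \<Delta> * (c - c') * q"
  have Ej: "E j - E' j = (\<Delta> * (c - c')) *s e j'"
    unfolding E_def E'_def shear_def by (simp add: vec_eq_iff algebra_simps)
  have Ej': "E j' = e j'" unfolding E_def shear_def using j by simp
  define n where "n i = r * lam i + (if i = j then q * lam j' else 0)" for i
  define n' where "n' i = (if i = j then q * lam j' else 0)" for i
  have "\<Delta> *s x = (\<Sum>i\<in>UNIV. lam i *s E i)"
    unfolding lam_def using cramer_identity[of E x] det[of c] \<Delta> unfolding E_def by simp
  also have "\<dots> = lam j' *s E j' + (\<Sum>i\<in>UNIV - {j'}. lam i *s E i)"
    by (rule sum.remove) auto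
  finally have cr: "\<Delta> *s x = lam j' *s e j' + (\<Sum>i\<in>UNIV - {j'}. lam i *s E i)" by (simp add: Ej')
  have "(k * L) *s x = (k * \<Delta> * r) *s (\<Delta> *s x)"
    unfolding q r_def by (simp add: power3_eq_cube mult_ac)
  also have "\<dots> = (k * \<Delta>) *s (r *s (\<Sum>i\<in>UNIV - {j'}. lam i *s E i) + (r * lam j') *s e j')"
    unfolding cr by (simp add: vector_add_ldistrib add.commute mult.assoc)
  also have "(r * lam j') *s e j' = (q * lam j') *s (E j - E' j)"
    unfolding Ej r_def by (simp add: mult_ac)
  also have "r *s (\<Sum>i\<in>UNIV - {j'}. lam i *s E i) + (q * lam j') *s (E j - E' j)
     = (\<Sum>i\<in>UNIV - {j'}. n i *s E i) - (\<Sum>i\<in>UNIV - {j'}. n' i *s E' i)"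
  proof -
    have "(\<Sum>i\<in>UNIV - {j'}. n' i *s E' i) = (q * lam j') *s E' j"
      unfolding n'_def by (rule sum_single) (use j in simp)
    moreover have "(\<Sum>i\<in>UNIV - {j'}. n i *s E i)
        = (\<Sum>i\<in>UNIV - {j'}. (r * lam i) *s E i) + (\<Sum>i\<in>UNIV - {j'}. (if i = j then q * lam j' else 0) *s E i)"
      unfolding n_def by (simp add: vector_sadd_rdistrib sum.distrib)
    moreover have "(\<Sum>i\<in>UNIV - {j'}. (if i = j then q * lam j' else 0) *s E i) = (q * lam j') *s E j"
      by (rule sum_single) (use j in simp)
    moreover have "(\<Sum>i\<in>UNIV - {j'}. (r * lam i) *s E i) = r *s (\<Sum>i\<in>UNIV - {j'}. lam i *s E i)"
      by (simp add: vec_eq_iff sum_distrib_left mult.assoc)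
    ultimately show ?thesis by (simp add: vec_eq_iff algebra_simps)
  qed
  also have "(k * \<Delta>) *s ((\<Sum>i\<in>UNIV - {j'}. n i *s E i) - (\<Sum>i\<in>UNIV - {j'}. n' i *s E' i))
    = (k * \<Delta>) *s (\<Sum>i\<in>UNIV - {j'}. n i *s E i) - (k * \<Delta>) *s (\<Sum>i\<in>UNIV - {j'}. n' i *s E' i)"
    by (simp add: vec_eq_iff algebra_simps)
  finally show ?thesis
    unfolding E_def[symmetric] E'_def[symmetric]
    using complementary_spanI[of "k * \<Delta>" n E j'] complementary_spanI[of "k * \<Delta>" n' E' j'] by blast
qed

section \<open>Multiple recurrence along a sheared frame\<close>

text \<open>Bernoulli's inequality, rescaled: \<open>x\<^sup>n\<close> lies above its tangent at \<open>\<delta>\<close>.\<close>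
lemma power_ge_tangent:
  fixes x \<delta> :: real
  assumes "0 \<le> x" "0 < \<delta>"
  shows "\<delta> ^ n + real n * \<delta> ^ (n - 1) * (x - \<delta>) \<le> x ^ n"
proof (cases n)
  case (Suc m)
  have "1 + real n * (x / \<delta> - 1) \<le> (1 + (x / \<delta> - 1)) ^ n"
    by (rule Bernoulli_inequality) (use assms in simp)
  then have "\<delta> ^ n * (1 + real n * (x / \<delta> - 1)) \<le> \<delta> ^ n * (x / \<delta>) ^ n"
    using assms by (intro mult_left_mono) auto
  also have "\<dots> = x ^ n" using assms by (simp add: power_divide)
  finally have "\<delta> ^ n * (1 + real n * (x / \<delta> - 1)) \<le> x ^ n" .
  moreover have "\<delta> ^ n * (1 + real n * (x / \<delta> - 1)) = \<delta> ^ n + real n * \<delta> ^ (n - 1) * (x - \<delta>)"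
    using assms Suc by (simp add: field_simps)
  ultimately show ?thesis by simp
qed simp

text \<open>The order of choices behind the parameters: \<open>\<epsilon>\<close> depends on the lower bound for the measure of the set, \<open>J\<close> on \<open>\<epsilon>\<close>, \<open>\<eta>\<close> on \<open>\<epsilon>\<close> and \<open>J\<close>, \<open>L\<close> on \<open>D\<close> and \<open>J\<close>, and \<open>k\<close> on
  the system. \<open>J\<close> is the number of shears compared with each other, large enough for the exceptional ones to be a
  proportion below \<open>\<epsilon>\<close>.\<close>
locale lattice_recurrence = almost_invariant_average M T f \<Gamma> \<Lambda> \<eta>
  for M :: "'a measure" and T :: "int ^ 'd::finite \<Rightarrow> 'a \<Rightarrow> 'a" and f \<Gamma> \<Lambda> \<eta> +
  fixes \<epsilon> :: real and k D J :: nat and L :: int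
  assumes \<epsilon>: "0 < \<epsilon>" "\<epsilon> \<le> 1" and \<eta>: "0 < \<eta>" "\<eta> \<le> \<epsilon>"
    and \<Lambda>: "\<Lambda> = {(int k * L) *s x | x. True}"
    and coarse_invariant: "nrm (translate (int k *s x) (\<Gamma> f) - \<Gamma> f) \<le> \<epsilon>"
    and J_\<eta>: "16 * (real J)\<^sup>2 * \<eta> \<le> 1" and J_\<epsilon>: "2 < real J * \<epsilon> ^ 3"
    and L: "0 < \<bar>\<Delta>\<bar> \<Longrightarrow> \<bar>\<Delta>\<bar> \<le> int D \<Longrightarrow> c \<noteq> c' \<Longrightarrow> c < J \<Longrightarrow> c' < J \<Longrightarrow>
      \<Delta> ^ 3 * (int c - int c') dvd L"
begin

text \<open>An index \<open>j\<close> is ready to be treated if \<open>f\<close> averages to almost \<open>g\<close> over the vectors by which \<open>k b\<^sub>j\<close> can move.\<close>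
abbreviation "adapted \<Delta> b j \<equiv> approximates (2 * \<epsilon>) (complementary_span (int k * \<Delta>) b j)"

lemma few_bad_shears:
  assumes eq: "sl_equivalent v b" and \<Delta>: "\<Delta> = det (column_matrix v)" "0 < \<bar>\<Delta>\<bar>" "\<bar>\<Delta>\<bar> \<le> int D"
    and j: "j' \<noteq> j"
  shows "real (card {c \<in> {..<J}. \<not> adapted \<Delta> (shear \<Delta> b j j' (int c)) j'}) < real J * \<epsilon>"
proof -
  let ?C = "{c \<in> {..<J}. \<not> adapted \<Delta> (shear \<Delta> b j j' (int c)) j'}"
  let ?G = "\<lambda>c. complementary_span (int k * \<Delta>) (shear \<Delta> b j j' (int c)) j'"
  have card: "card ?C \<le> J" using card_mono[of "{..<J}" ?C] by auto
  have det: "det (column_matrix (shear \<Delta> b j j' c)) = \<Delta>" for c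
    using sl_equivalent_det[OF sl_equivalent_shear_single[OF eq \<Delta>(1) _ j]] \<Delta> by auto
  have "real (card ?C) * \<epsilon>\<^sup>2 \<le> 2"
  proof (rule few_not_approximating[where G = ?G and K = "{int k *s x | x. True}"])
    show "16 * (real (card ?C))\<^sup>2 * \<eta> \<le> 1"
    proof -
      have "(real (card ?C))\<^sup>2 \<le> (real J)\<^sup>2" using card by (intro power_mono) auto
      then have "16 * (real (card ?C))\<^sup>2 * \<eta> \<le> 16 * (real J)\<^sup>2 * \<eta>" using \<eta> by (intro mult_right_mono) auto
      then show ?thesis using J_\<eta> by linarith
    qed
    show "?G c \<subseteq> {int k *s x | x. True}" for c
    proof
      fix u assume "u \<in> ?G c"
      then obtain n where "u = (int k * \<Delta>) *s (\<Sum>i\<in>UNIV - {j'}. n i *s shear \<Delta> b j j' (int c) i)"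
        unfolding complementary_span_def by blast
      then have "u = int k *s (\<Delta> *s (\<Sum>i\<in>UNIV - {j'}. n i *s shear \<Delta> b j j' (int c) i))" by simp
      then show "u \<in> {int k *s x | x. True}" by blast
    qed
    show "\<exists>h\<in>?G c. \<exists>h'\<in>?G c'. w = h - h'"
      if c: "c \<in> ?C" "c' \<in> ?C" "c \<noteq> c'" and w: "w \<in> \<Lambda>" for c c' w
    proof -
      obtain x where "w = (int k * L) *s x" using w unfolding \<Lambda> by blast
      moreover have "\<Delta> ^ 3 * (int c - int c') dvd L" using L \<Delta> c by auto
      ultimately show ?thesis using complementary_spans_spread[OF det _ j] \<Delta>(2) by auto
    qed
  qed (use \<epsilon> \<eta> coarse_invariant in \<open>auto intro: zero_in_complementary_span add_in_complementary_span\<close>)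
  also have "2 < (real J * \<epsilon>) * \<epsilon>\<^sup>2" using J_\<epsilon> by (simp add: power3_eq_cube power2_eq_square mult.assoc)
  finally show ?thesis using \<epsilon> by simp
qed

text \<open>The translates with index in \<open>S\<close> are in place; each of the \<open>m\<close> remaining ones is represented by \<open>g\<close>.\<close>
definition weight :: "nat \<Rightarrow> 'd set \<Rightarrow> ('d \<Rightarrow> int ^ 'd) \<Rightarrow> 'a \<Rightarrow> real" where
  "weight m S b = f * g ^ m * (\<Prod>i\<in>S. translate (int k *s b i) f)"

lemma weight_Obs: "weight m S b \<in> Obs"
  unfolding weight_def by (intro Obs_mult Obs_power Obs_prod Obs_translate f_Obs g_Obs)

lemma pointwise_power: "(u ^ n) x = u x ^ n" for u :: "'a \<Rightarrow> real"
  by (induction n) (simp_all add: times_fun_apply one_fun_def)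

lemma pointwise_prod: "(\<Prod>i\<in>S. u i) x = (\<Prod>i\<in>S. u i x)" for u :: "'d \<Rightarrow> 'a \<Rightarrow> real"
  by (induction S rule: infinite_finite_induct) (simp_all add: times_fun_apply one_fun_def)

lemma weight_apply: "weight m S b x = f x * g x ^ m * (\<Prod>i\<in>S. f (T (int k *s b i) x))"
  unfolding weight_def by (simp add: times_fun_apply pointwise_power pointwise_prod translate_def)

lemma weight_bounds: "0 \<le> weight m S b x" "weight m S b x \<le> 1"
proof -
  have p: "0 \<le> (\<Prod>i\<in>S. f (T (int k *s b i) x))" "(\<Prod>i\<in>S. f (T (int k *s b i) x)) \<le> 1"
    using f_ge f_le by (auto intro: prod_nonneg prod_le_1)
  show "0 \<le> weight m S b x" unfolding weight_apply using p f_ge g_bounds by simp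
  show "weight m S b x \<le> 1" unfolding weight_apply
    using p f_ge[of x] f_le[of x] g_bounds[of x] by (intro mult_le_one power_le_one) auto
qed

text \<open>As \<open>g\<^sup>m\<close> is almost \<open>\<Lambda>\<close>-invariant, \<open>f\<close> may be replaced by its average \<open>g\<close> in the integral of \<open>f g\<^sup>m\<close>. By convexity the
  integral of \<open>g\<^bsup>m+1\<^esup>\<close> is at least \<open>\<delta>\<^bsup>m+1\<^esup>\<close>, because \<open>g\<close> and \<open>f\<close> have the same integral.\<close>
lemma correlation_initial:
  assumes \<delta>: "0 < \<delta>" "\<delta> \<le> expectation f"
  shows "\<delta> ^ Suc m - real m * \<epsilon> \<le> expectation (weight m {} b)"
proof -
  have gm: "g ^ m \<in> Obs" by (intro Obs_power g_Obs)
  have "\<bar>ip (translate h f) (g ^ m) - ip f (g ^ m)\<bar> \<le> real m * \<eta>" if h: "h \<in> \<Lambda>" for h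
  proof -
    let ?u = "translate h (g ^ m) - g ^ m" and ?v = "translate h g - g"
    have O: "?u \<in> Obs" "?v \<in> Obs" using gm g_Obs by (auto intro: Obs_diff Obs_translate)
    have "ip f (g ^ m) = ip (translate h f) (translate h (g ^ m))"
      using f_Obs gm by (simp add: ip_translate)
    then have "ip (translate h f) (g ^ m) - ip f (g ^ m) = - ip (translate h f) ?u"
      using f_Obs gm by (simp add: ip_diff_right Obs_translate)
    moreover have "\<bar>ip (translate h f) ?u\<bar> \<le> nrm (translate h f) * nrm ?u"
      using f_Obs O by (intro cauchy_schwarz Obs_translate)
    moreover have "nrm (translate h f) * nrm ?u \<le> 1 * nrm ?u"
      using nrm_f_le f_Obs nrm_nonneg by (intro mult_right_mono) (auto simp: nrm_translate)
    moreover have "nrm ?u \<le> real m * nrm ?v"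
    proof (rule nrm_le_scaled[OF O])
      show "\<bar>?u x\<bar> \<le> real m * \<bar>?v x\<bar>" for x
        using norm_power_diff[of "g (T h x)" "g x" m] g_bounds
        by (simp add: minus_apply translate_def pointwise_power)
    qed simp
    moreover have "real m * nrm ?v \<le> real m * \<eta>"
      using fine_invariant[OF h] by (intro mult_left_mono) auto
    ultimately show ?thesis by linarith
  qed
  then have "\<bar>ip g (g ^ m) - ip f (g ^ m)\<bar> \<le> real m * \<eta>"
    by (rule averaging_ip_close[OF \<Gamma> f_Obs gm])
  moreover have "real m * \<eta> \<le> real m * \<epsilon>" using \<eta> by (intro mult_left_mono) auto
  moreover have "\<delta> ^ Suc m \<le> ip g (g ^ m)"
  proof -
    let ?l = "(\<lambda>_. \<delta> ^ Suc m - real (Suc m) * \<delta> ^ m * \<delta>) + (\<lambda>_. real (Suc m) * \<delta> ^ m) * g"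
    have O: "?l \<in> Obs" "g ^ Suc m \<in> Obs" using g_Obs by (auto intro: Obs_intros)
    have "expectation ?l = (\<delta> ^ Suc m - real (Suc m) * \<delta> ^ m * \<delta>) + real (Suc m) * \<delta> ^ m * expectation g"
      using ip_scale_right[of 1 "real (Suc m) * \<delta> ^ m" g] g_Obs
      by (simp add: expectation_add Obs_mult Obs_const ip_def prob_space)
    moreover have "expectation g = expectation f" by (rule averaging_expectation[OF \<Gamma> f_Obs])
    moreover have "real (Suc m) * \<delta> ^ m * \<delta> \<le> real (Suc m) * \<delta> ^ m * expectation f"
      using \<delta> by (intro mult_left_mono) auto
    ultimately have "\<delta> ^ Suc m \<le> expectation ?l" by simp
    also have "\<dots> \<le> expectation (g ^ Suc m)"
    proof (rule expectation_mono[OF O])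
      show "?l x \<le> (g ^ Suc m) x" for x
        using power_ge_tangent[of "g x" \<delta> "Suc m"] g_bounds(1)[of x] \<delta>
        by (simp add: plus_fun_apply times_fun_apply pointwise_power algebra_simps)
    qed
    finally show ?thesis by (simp add: ip_def)
  qed
  moreover have "ip f (g ^ m) = expectation (weight m {} b)" unfolding ip_def weight_def by simp
  ultimately show ?thesis by linarith
qed

text \<open>One factor \<open>g\<close> is exchanged for a translate of \<open>f\<close>. Write \<open>g\<close> as an average of translates of \<open>f\<close> by vectors of the
  complementary span of \<open>j\<close>, up to \<open>2\<epsilon>\<close>; shifting by \<open>u c\<close>, which lies in \<open>k \<int>\<^sup>d\<close>, costs another \<open>\<epsilon>\<close>. Some
  element \<open>h\<close> of the span does as well as the average, simultaneously on average over \<open>c < J\<close>. Among these \<open>c\<close> fewer than \<open>\<epsilon> J\<close> fail to make \<open>j'\<close>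
  adapted; dropping them costs a last \<open>\<epsilon>\<close>.\<close>
lemma correlation_step:
  assumes eq: "sl_equivalent v b" and \<Delta>: "\<Delta> = det (column_matrix v)" "0 < \<bar>\<Delta>\<bar>" "\<bar>\<Delta>\<bar> \<le> int D"
    and j: "j' \<noteq> j" "j \<notin> S" and good: "adapted \<Delta> b j"
    and t: "t \<le> expectation (weight (Suc m) S b)" "4 * \<epsilon> \<le> t"
  obtains b' where "sl_equivalent v b'" "adapted \<Delta> b' j'"
    "t - 4 * \<epsilon> \<le> expectation (weight m (insert j S) b')"
proof -
  define W where "W = weight m S b"
  have W: "W \<in> Obs" unfolding W_def by (rule weight_Obs)
  have W1: "nrm W \<le> 1"
    unfolding W_def using weight_bounds[of m S b]
    by (intro nrm_le_one weight_Obs) (simp add: abs_le_iff order_trans[of "- _" 0])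
  obtain \<Phi> where \<Phi>: "averaging (complementary_span (int k * \<Delta>) b j) \<Phi>" and close: "nrm (\<Phi> f - g) \<le> 2 * \<epsilon>"
    using good unfolding approximates_def by blast
  define u where "u c = int k *s (b j + (\<Delta> * int c) *s b j')" for c
  have "t - 3 * \<epsilon> \<le> ip (\<Phi> (translate (u c) f)) W" for c
  proof -
    have O: "\<Phi> f \<in> Obs" by (rule averaging_Obs[OF \<Phi> f_Obs])
    have e: "\<Phi> (translate (u c) f) = translate (u c) (\<Phi> f)" by (rule averaging_commute_translate[OF \<Phi>])
    have "nrm (translate (u c) (\<Phi> f) - translate (u c) g) \<le> 2 * \<epsilon>"
      using close nrm_translate[OF Obs_diff[OF O g_Obs], of "u c"] by (simp add: translate_diff)
    moreover have "nrm (translate (u c) g - g) \<le> \<epsilon>" unfolding u_def by (rule coarse_invariant)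
    ultimately have n: "nrm (translate (u c) (\<Phi> f) - g) \<le> 3 * \<epsilon>"
      using nrm_diff_triangle[OF Obs_translate[OF O, of "u c"] Obs_translate[OF g_Obs, of "u c"] g_Obs]
      by linarith
    have O': "translate (u c) (\<Phi> f) - g \<in> Obs" using O g_Obs by (intro Obs_diff Obs_translate)
    have "\<bar>ip (translate (u c) (\<Phi> f) - g) W\<bar> \<le> nrm (translate (u c) (\<Phi> f) - g) * nrm W"
      by (rule cauchy_schwarz[OF O' W])
    also have "\<dots> \<le> (3 * \<epsilon>) * 1" using n W1 nrm_nonneg \<epsilon> by (intro mult_mono) auto
    finally have "ip g W - 3 * \<epsilon> \<le> ip (translate (u c) (\<Phi> f)) W"
      using O g_Obs W by (simp add: ip_diff_left Obs_translate abs_le_iff)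
    moreover have "ip g W = expectation (weight (Suc m) S b)"
      unfolding ip_def W_def weight_def by (simp add: mult_ac)
    ultimately show ?thesis using t(1) e by simp
  qed
  then have "(\<Sum>c\<in>{..<J}. t - 3 * \<epsilon>) \<le> (\<Sum>c\<in>{..<J}. ip (\<Phi> (translate (u c) f)) W)" by (rule sum_mono)
  then have "real J * (t - 3 * \<epsilon>) \<le> (\<Sum>c\<in>{..<J}. ip (\<Phi> (translate (u c) f)) W)" by simp
  then obtain h where h: "h \<in> complementary_span (int k * \<Delta>) b j"
    and sum_ge: "real J * (t - 3 * \<epsilon>) \<le> (\<Sum>c\<in>{..<J}. ip (translate h (translate (u c) f)) W)"
    using averaging_ip_sum_ge[OF \<Phi>, where y = "\<lambda>c. translate (u c) f" and z = "\<lambda>_. W" and C = "{..<J}"]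
      Obs_translate[OF f_Obs] W by blast
  obtain n where n: "h = (int k * \<Delta>) *s (\<Sum>i\<in>UNIV - {j}. n i *s b i)"
    using h unfolding complementary_span_def by blast
  \<comment> \<open>The shear that realises the translation by \<open>h\<close>; the further shear by \<open>c\<close> realises \<open>u c\<close>.\<close>
  define e where "e = b(j := b j + \<Delta> *s (\<Sum>i\<in>UNIV - {j}. n i *s b i))"
  have e_eq: "sl_equivalent v e"
    unfolding e_def using sl_equivalent_shear[OF eq \<Delta>(1)] \<Delta>(2) by auto
  define a where "a c = expectation (weight m (insert j S) (shear \<Delta> e j j' (int c)))" for c
  have a: "a c = ip (translate h (translate (u c) f)) W" for c
  proof -
    define b' where "b' = shear \<Delta> e j j' (int c)"
    have "int k *s b' j = h + u c"
      unfolding b'_def shear_def e_def n u_def using j by (simp add: vec_eq_iff algebra_simps)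
    moreover have "b' i = b i" if "i \<in> S" for i
      using that j unfolding b'_def shear_def e_def by auto
    ultimately have "weight m (insert j S) b' = translate (h + u c) f * W"
      unfolding weight_def W_def using j by (simp add: mult_ac)
    then show ?thesis unfolding a_def ip_def b'_def by (simp add: translate_translate)
  qed
  have a1: "a c \<le> 1" for c
    unfolding a_def using weight_bounds weight_Obs
    by (intro order_trans[OF expectation_mono[OF weight_Obs Obs_const[of 1]]]) (auto simp: prob_space)
  define Bad where "Bad = {c \<in> {..<J}. \<not> adapted \<Delta> (shear \<Delta> e j j' (int c)) j'}"
  have bad: "real (card Bad) < real J * \<epsilon>"
    unfolding Bad_def by (rule few_bad_shears[OF e_eq \<Delta> j(1)])
  have "\<exists>c\<in>{..<J} - Bad. t - 4 * \<epsilon> \<le> a c"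
  proof (rule ccontr)
    assume "\<not> ?thesis"
    then have "a c \<le> t - 4 * \<epsilon>" if "c \<in> {..<J} - Bad" for c
      using that by (simp add: not_le less_imp_le)
    then have "(\<Sum>c\<in>{..<J} - Bad. a c) \<le> (\<Sum>c\<in>{..<J} - Bad. t - 4 * \<epsilon>)"
      by (rule sum_mono)
    also have "\<dots> \<le> real J * (t - 4 * \<epsilon>)"
      using t(2) card_mono[of "{..<J}" "{..<J} - Bad"] by (simp add: mult_right_mono)
    finally have g: "(\<Sum>c\<in>{..<J} - Bad. a c) \<le> real J * (t - 4 * \<epsilon>)" .
    have "(\<Sum>c\<in>{..<J}. a c) = (\<Sum>c\<in>{..<J} - Bad. a c) + (\<Sum>c\<in>Bad. a c)"
      by (rule sum.subset_diff) (auto simp: Bad_def)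
    moreover have "(\<Sum>c\<in>Bad. a c) \<le> real (card Bad)"
      using sum_mono[of Bad a "\<lambda>_. 1"] a1 by simp
    moreover have "real J * (t - 3 * \<epsilon>) \<le> (\<Sum>c\<in>{..<J}. a c)" using sum_ge by (simp add: a)
    ultimately show False using g bad by (simp add: algebra_simps)
  qed
  then obtain c where c: "c < J" "c \<notin> Bad" "t - 4 * \<epsilon> \<le> a c" by auto
  show ?thesis
  proof (rule that[of "shear \<Delta> e j j' (int c)"])
    show "sl_equivalent v (shear \<Delta> e j j' (int c))"
      using sl_equivalent_shear_single[OF e_eq \<Delta>(1) _ j(1)] \<Delta>(2) by auto
    show "adapted \<Delta> (shear \<Delta> e j j' (int c)) j'" using c by (simp add: Bad_def)
    show "t - 4 * \<epsilon> \<le> expectation (weight m (insert j S) (shear \<Delta> e j j' (int c)))"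
      using c(3) unfolding a_def .
  qed
qed

text \<open>Induction on the set \<open>S\<close> of treated indices: whichever index outside \<open>S\<close> comes next can be made adapted, and the integral of
  the weight has dropped by at most \<open>4\<epsilon>\<close> per index. For the first index some shear in another
  direction makes it adapted. At the last index nothing is left to prepare, and any other index serves as \<open>j'\<close>; like the
  first step, this uses \<open>d \<ge> 2\<close>.\<close>
lemma positive_correlation:
  fixes v :: "'d \<Rightarrow> int ^ 'd"
  assumes d: "2 \<le> CARD('d)" and \<Delta>: "0 < \<bar>det (column_matrix v)\<bar>" "\<bar>det (column_matrix v)\<bar> \<le> int D"
    and \<delta>: "0 < \<delta>" "\<delta> \<le> expectation f" "5 * real CARD('d) * \<epsilon> < \<delta> ^ Suc CARD('d)"
  obtains b where "sl_equivalent v b" "0 < (\<integral>x. f x * (\<Prod>i\<in>UNIV. f (T (int k *s b i) x)) \<partial>M)"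
proof -
  define \<Delta>' where "\<Delta>' = det (column_matrix v)"
  note \<Delta>' = \<Delta>'_def \<Delta>[folded \<Delta>'_def]
  define s where "s n = \<delta> ^ Suc CARD('d) - real CARD('d) * \<epsilon> - 4 * real n * \<epsilon>" for n
  have other: "\<exists>j'. j' \<noteq> j" for j :: 'd
  proof (rule ccontr)
    assume "\<not> ?thesis"
    then have "(UNIV :: 'd set) = {j}" by auto
    then have "CARD('d) = 1" by (metis card.empty card.insert empty_iff finite.emptyI One_nat_def)
    then show False using d by simp
  qed
  have s_step: "4 * \<epsilon> \<le> s n" if n: "n < CARD('d)" for n
  proof -
    have "4 * real (Suc n) * \<epsilon> \<le> 4 * real CARD('d) * \<epsilon>" using n \<epsilon> by (intro mult_right_mono) auto
    then show ?thesis using \<delta>(3) unfolding s_def by (simp add: algebra_simps)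
  qed
  have main: "\<forall>j. j \<notin> S \<longrightarrow> (\<exists>b. sl_equivalent v b \<and> adapted \<Delta>' b j \<and>
      s (card S) \<le> expectation (weight (CARD('d) - card S) S b))" if "finite S" for S :: "'d set"
    using that
  proof (induction S)
    case empty
    show ?case
    proof (intro allI impI)
      fix j' :: 'd
      obtain j where j: "j' \<noteq> j" using other by metis
      let ?Bad = "{c \<in> {..<J}. \<not> adapted \<Delta>' (shear \<Delta>' v j j' (int c)) j'}"
      have "real (card ?Bad) < real J * \<epsilon>"
        by (rule few_bad_shears[OF sl_equivalent_refl \<Delta>' j])
      also have "\<dots> \<le> real J * 1" using \<epsilon> by (intro mult_left_mono) auto
      finally have "card ?Bad < card {..<J}" by simp
      then have "?Bad \<noteq> {..<J}" by force
      then obtain c where "c < J" "adapted \<Delta>' (shear \<Delta>' v j j' (int c)) j'" by blast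
      moreover have "sl_equivalent v (shear \<Delta>' v j j' (int c))"
        using sl_equivalent_shear_single[OF sl_equivalent_refl \<Delta>'(1) _ j] \<Delta>'(2) by auto
      moreover have "s 0 \<le> expectation (weight CARD('d) {} (shear \<Delta>' v j j' (int c)))"
        unfolding s_def using correlation_initial[OF \<delta>(1,2)] by simp
      ultimately show "\<exists>b. sl_equivalent v b \<and> adapted \<Delta>' b j' \<and>
          s (card {}) \<le> expectation (weight (CARD('d) - card {}) {} b)" by auto
    qed
  next
    case (insert x S)
    show ?case
    proof (intro allI impI)
      fix j assume j: "j \<notin> insert x S"
      obtain b where b: "sl_equivalent v b" "adapted \<Delta>' b x"
        "s (card S) \<le> expectation (weight (CARD('d) - card S) S b)"
        using insert by blast
      have lt: "card S < CARD('d)" using insert by (intro psubset_card_mono) auto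
      have "CARD('d) - card S = Suc (CARD('d) - card (insert x S))" using insert lt by simp
      with b(3) have "s (card S) \<le> expectation (weight (Suc (CARD('d) - card (insert x S))) S b)" by simp
      then obtain b' where "sl_equivalent v b'" "adapted \<Delta>' b' j"
        "s (card S) - 4 * \<epsilon> \<le> expectation (weight (CARD('d) - card (insert x S)) (insert x S) b')"
        using correlation_step[OF b(1) \<Delta>' _ insert(2) b(2) _ s_step[OF lt], of j] j by blast
      moreover have "s (card (insert x S)) = s (card S) - 4 * \<epsilon>"
        unfolding s_def using insert by (simp add: algebra_simps)
      ultimately show "\<exists>b. sl_equivalent v b \<and> adapted \<Delta>' b j \<and>
          s (card (insert x S)) \<le> expectation (weight (CARD('d) - card (insert x S)) (insert x S) b)"
        by metis
    qed
  qed
  obtain x :: 'd where True by blast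
  let ?S = "UNIV - {x}"
  have cS: "card ?S = CARD('d) - 1" by (simp add: card_Diff_singleton)
  have lt: "card ?S < CARD('d)" using d cS by simp
  obtain b where b: "sl_equivalent v b" "adapted \<Delta>' b x"
    "s (card ?S) \<le> expectation (weight (CARD('d) - card ?S) ?S b)"
    using main[of ?S] by auto
  have "CARD('d) - card ?S = Suc 0" using d cS by simp
  with b(3) have "s (card ?S) \<le> expectation (weight (Suc 0) ?S b)" by simp
  moreover obtain y where "y \<noteq> x" using other by blast
  ultimately obtain b' where b': "sl_equivalent v b'"
    "s (card ?S) - 4 * \<epsilon> \<le> expectation (weight 0 (insert x ?S) b')"
    using correlation_step[OF b(1) \<Delta>' _ _ b(2) _ s_step[OF lt], of y ?S 0] by blast
  have "real (card ?S) + 1 = real CARD('d)" using d cS by simp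
  then have "4 * real (card ?S) * \<epsilon> + 4 * \<epsilon> = 4 * real CARD('d) * \<epsilon>"
    by (metis distrib_left distrib_right mult.assoc mult.right_neutral)
  then have "0 < s (card ?S) - 4 * \<epsilon>" unfolding s_def using \<delta>(3) by (simp add: algebra_simps)
  moreover have "weight 0 (insert x ?S) b' = (\<lambda>y. f y * (\<Prod>i\<in>UNIV. f (T (int k *s b' i) y)))"
    by (simp add: fun_eq_iff weight_apply insert_absorb)
  ultimately show ?thesis using that b' by simp
qed

end

section \<open>A bound that serves all systems\<close>

lemma (in pmp_action) action_space: "x \<in> space M \<Longrightarrow> T v x \<in> space M"
  using action_measurable measurable_space by metis

lemma (in pmp_action) action_inverse: "x \<in> space M \<Longrightarrow> T v (T (- v) x) = x" "x \<in> space M \<Longrightarrow> T (- v) (T v x) = x"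
  using action_add[of x v "- v"] action_add[of x "- v" v] action_zero by simp_all

lemma (in pmp_action) action_image:
  assumes "A \<in> sets M"
  shows "T w ` A = T (- w) -` A \<inter> space M"
proof -
  have A: "A \<subseteq> space M" using assms by (rule sets.sets_into_space)
  show ?thesis
  proof
    show "T w ` A \<subseteq> T (- w) -` A \<inter> space M"
      using A action_space action_inverse(2) by auto
    show "T (- w) -` A \<inter> space M \<subseteq> T w ` A"
    proof
      fix x assume "x \<in> T (- w) -` A \<inter> space M"
      then have "T (- w) x \<in> A" "x = T w (T (- w) x)" using action_inverse(1)[of x w] by auto
      then show "x \<in> T w ` A" by blast
    qed
  qed
qed

lemma (in pmp_action) action_image_sets: "A \<in> sets M \<Longrightarrow> T w ` A \<in> sets M"
  using action_image action_measurable measurable_sets by metis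

text \<open>The indicator of \<open>T w ` A\<close> at \<open>x\<close> is that of \<open>A\<close> at \<open>T (- w) x\<close>, so for the inverse action the translates of the
  indicator of \<open>A\<close> are the indicators of the images of \<open>A\<close>.\<close>
lemma (in pmp_action) commuting_action_inverse:
  "commuting_action M (\<lambda>v x. if x \<in> space M then T (- v) x else x)" (is "commuting_action M ?T")
proof
  fix u v x
  show "?T 0 x = x" using action_zero by simp
  show "?T (u + v) x = ?T u (?T v x)"
    using action_add[of x "- u" "- v"] action_space by (simp add: add.commute)
  have c: "?T v x = T (- v) x" if "x \<in> space M" for x using that by simp
  show "?T v \<in> measurable M M"
    using measurable_cong[of M "?T v" "T (- v)" M] c action_measurable by blast
  show "distr M M (?T v) = M"
    using distr_cong[of M M M M "?T v" "T (- v)"] c action_preserving by metis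
qed

lemma multiple_ladder_inclusion:
  "{int (L ^ Suc i) *s x | x :: int ^ 'd::finite. True} \<subseteq> {int (L ^ i) *s x | x. True}"
proof
  fix u :: "int ^ 'd" assume "u \<in> {int (L ^ Suc i) *s x | x. True}"
  then obtain x where "u = int (L ^ i) *s (int L *s x)" by (auto simp: mult.commute)
  then show "u \<in> {int (L ^ i) *s x | x. True}" by blast
qed

lemma fact_power_divides:
  assumes "0 < \<bar>\<Delta>\<bar>" "\<bar>\<Delta>\<bar> \<le> int D" "c \<noteq> c'" "c < J" "c' < J"
  shows "\<Delta> ^ 3 * (int c - int c') dvd int (fact D ^ 3 * fact J)"
proof -
  have "nat \<bar>\<Delta>\<bar> dvd fact D" using assms by (intro dvd_fact) auto
  then have "int (nat \<bar>\<Delta>\<bar>) dvd int (fact D)" by (simp only: int_dvd_int_iff)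
  then have "\<Delta> ^ 3 dvd int (fact D) ^ 3" by (intro dvd_power_same) simp
  moreover have "nat \<bar>int c - int c'\<bar> dvd fact J" using assms by (intro dvd_fact) auto
  then have "int (nat \<bar>int c - int c'\<bar>) dvd int (fact J)" by (simp only: int_dvd_int_iff)
  then have "int c - int c' dvd int (fact J)" by simp
  ultimately show ?thesis unfolding of_nat_mult of_nat_power by (rule mult_dvd_mono)
qed

text \<open>The ladder of lattices is \<open>L\<^sup>i \<int>\<^sup>d\<close> with \<open>L = (D!)\<^sup>3 J!\<close>, so that \<open>L\<close> is a multiple of every
  \<open>\<Delta>\<^sup>3 (c - c')\<close> that occurs.\<close>
lemma recurrence_bound_exists:
  fixes D :: nat and \<delta> :: real
  assumes d: "2 \<le> CARD('d::finite)" and \<delta>: "0 < \<delta>"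
  shows "\<exists>K>0. recurrence_bound TYPE('a) TYPE('d) D \<delta> K"
proof -
  define \<delta>' where "\<delta>' = min \<delta> 1"
  have \<delta>': "0 < \<delta>'" "\<delta>' \<le> 1" "\<delta>' \<le> \<delta>" using \<delta> by (auto simp: \<delta>'_def)
  \<comment> \<open>There are \<open>d\<close> steps that cost \<open>4\<epsilon>\<close> each, and the initial estimate costs \<open>d \<epsilon>\<close>.\<close>
  define \<epsilon> where "\<epsilon> = \<delta>' ^ Suc CARD('d) / (5 * real CARD('d) + 1)"
  have \<epsilon>0: "0 < \<epsilon>" unfolding \<epsilon>_def using \<delta>' by (intro divide_pos_pos) auto
  have \<epsilon>_eq: "5 * real CARD('d) * \<epsilon> + \<epsilon> = \<delta>' ^ Suc CARD('d)"
  proof -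
    have "(5 * real CARD('d) + 1) * \<epsilon> = \<delta>' ^ Suc CARD('d)" unfolding \<epsilon>_def by simp
    then show ?thesis by (simp add: distrib_right)
  qed
  have \<epsilon>1: "\<epsilon> \<le> 1"
  proof -
    have "\<delta>' ^ Suc CARD('d) \<le> 1" using \<delta>' by (intro power_le_one) auto
    moreover have "0 \<le> 5 * real CARD('d) * \<epsilon>" using \<epsilon>0 by simp
    ultimately show ?thesis using \<epsilon>_eq by linarith
  qed
  obtain J :: nat where "2 / \<epsilon> ^ 3 < real J" using reals_Archimedean2 by blast
  then have J: "2 < real J * \<epsilon> ^ 3" using \<epsilon>0 by (simp add: field_simps)
  then have J0: "0 < real J" by (cases J) auto
  define \<eta> where "\<eta> = min \<epsilon> (1 / (16 * (real J)\<^sup>2))"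
  have \<eta>: "0 < \<eta>" "\<eta> \<le> \<epsilon>" unfolding \<eta>_def using \<epsilon>0 J0 by auto
  have J\<eta>: "16 * (real J)\<^sup>2 * \<eta> \<le> 1"
  proof -
    have "16 * (real J)\<^sup>2 * \<eta> \<le> 16 * (real J)\<^sup>2 * (1 / (16 * (real J)\<^sup>2))"
      unfolding \<eta>_def by (intro mult_left_mono) auto
    then show ?thesis using J0 by simp
  qed
  obtain R :: nat where "8 / \<epsilon>\<^sup>2 < real R" using reals_Archimedean2 by blast
  then have R: "8 \<le> real R * \<epsilon>\<^sup>2" using \<epsilon>0 by (simp add: field_simps)
  define L :: nat where "L = fact D ^ 3 * fact J"
  have L0: "1 \<le> L" unfolding L_def by (simp add: Suc_le_eq)
  have "recurrence_bound TYPE('a) TYPE('d) D \<delta> (L ^ R)"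
    unfolding recurrence_bound_def
  proof (intro allI impI)
    fix M :: "'a measure" and T :: "int ^ 'd \<Rightarrow> 'a \<Rightarrow> 'a" and A
    assume "ergodic_pmp_action M T" and A: "A \<in> sets M" and \<delta>A: "\<delta> \<le> measure M A"
    then interpret pmp_action M T by (simp add: ergodic_pmp_action_def)
    define S where "S v x = (if x \<in> space M then T (- v) x else x)" for v x
    interpret commuting_action M S unfolding S_def by (rule commuting_action_inverse)
    define f :: "'a \<Rightarrow> real" where "f = indicator A"
    have f_Obs: "f \<in> Obs" unfolding Obs_def f_def using A by (auto intro!: exI[of _ 1] simp: indicator_def)
    have f_nrm: "nrm f \<le> 1" by (rule nrm_le_one[OF f_Obs]) (simp add: f_def indicator_def)
    define H where "H i = {int (L ^ i) *s x | x :: int ^ 'd. True}" for i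
    have "\<exists>i<R. \<forall>\<eta>>0. \<exists>\<Phi>. averaging (H (Suc i)) \<Phi> \<and>
      (\<forall>h\<in>H (Suc i). nrm (translate h (\<Phi> f) - \<Phi> f) \<le> \<eta>) \<and>
      (\<forall>h\<in>H i. nrm (translate h (\<Phi> f) - \<Phi> f) \<le> \<epsilon>)"
    proof (rule energy_increment[OF _ _ _ f_Obs f_nrm \<epsilon>0 R])
      show "0 \<in> H i" for i unfolding H_def by (auto intro!: exI[of _ 0])
      show "u + v \<in> H i" if uv: "u \<in> H i" "v \<in> H i" for i u v
      proof -
        obtain x y where "u = int (L ^ i) *s x" "v = int (L ^ i) *s y" using uv unfolding H_def by blast
        then have "u + v = int (L ^ i) *s (x + y)" by (simp add: vector_add_ldistrib)
        then show ?thesis unfolding H_def by blast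
      qed
      show "H (Suc i) \<subseteq> H i" for i unfolding H_def by (rule multiple_ladder_inclusion)
    qed
    then obtain i \<Gamma> where i: "i < R" and \<Gamma>: "averaging (H (Suc i)) \<Gamma>"
      and fine: "\<And>h. h \<in> H (Suc i) \<Longrightarrow> nrm (translate h (\<Gamma> f) - \<Gamma> f) \<le> \<eta>"
      and coarse: "\<And>h. h \<in> H i \<Longrightarrow> nrm (translate h (\<Gamma> f) - \<Gamma> f) \<le> \<epsilon>"
      using \<eta>(1) by blast
    define k where "k = L ^ i"
    interpret lattice_recurrence M S f \<Gamma> "H (Suc i)" \<eta> \<epsilon> k D J "int L"
    proof
      show "H (Suc i) = {(int k * int L) *s x | x. True}" unfolding H_def k_def by (simp add: mult.commute)
      show "nrm (translate (int k *s x) (\<Gamma> f) - \<Gamma> f) \<le> \<epsilon>" for x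
        by (rule coarse) (auto simp: H_def k_def)
      show "\<Delta> ^ 3 * (int c - int c') dvd int L"
        if "0 < \<bar>\<Delta>\<bar>" "\<bar>\<Delta>\<bar> \<le> int D" "c \<noteq> c'" "c < J" "c' < J" for \<Delta> c c'
        unfolding L_def using that by (rule fact_power_divides)
    qed (use f_Obs \<Gamma> fine \<epsilon>0 \<epsilon>1 \<eta> J J\<eta> in \<open>auto simp: f_def\<close>)
    have "1 \<le> k" unfolding k_def using L0 by (rule one_le_power)
    moreover have "k \<le> L ^ R" unfolding k_def using L0 i by (intro power_increasing) auto
    moreover have "\<exists>\<gamma> :: int ^ 'd ^ 'd. det \<gamma> = 1 \<and>
        measure M (A \<inter> (\<Inter>i. T (\<gamma> *v (int k *s v i)) ` A)) > 0"
      if v: "0 < \<bar>det (column_matrix v)\<bar>" "\<bar>det (column_matrix v)\<bar> \<le> int D" for v :: "'d \<Rightarrow> int ^ 'd"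
    proof -
      have e: "\<delta>' \<le> expectation f" using \<delta>'(3) \<delta>A A by (simp add: f_def)
      have s: "5 * real CARD('d) * \<epsilon> < \<delta>' ^ Suc CARD('d)" using \<epsilon>_eq \<epsilon>0 by linarith
      obtain b where b: "sl_equivalent v b"
        and pos: "0 < (\<integral>x. f x * (\<Prod>i\<in>UNIV. f (S (int k *s b i) x)) \<partial>M)"
        using positive_correlation[OF d v \<delta>'(1) e s] by blast
      obtain \<gamma> :: "int ^ 'd ^ 'd" where \<gamma>: "det \<gamma> = 1" "\<And>i. b i = \<gamma> *v v i"
        using b unfolding sl_equivalent_def by blast
      define B where "B = A \<inter> (\<Inter>i. T (\<gamma> *v (int k *s v i)) ` A)"
      have "f x * (\<Prod>i\<in>UNIV. f (S (int k *s b i) x)) = indicator B x" if x: "x \<in> space M" for x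
      proof -
        have "f (S (int k *s b i) x) = indicator (T (\<gamma> *v (int k *s v i)) ` A) x" for i
          using x unfolding f_def S_def action_image[OF A] \<gamma>(2)
          by (auto simp: indicator_def matrix_vector_mult_scale)
        then have "(\<Prod>i\<in>UNIV. f (S (int k *s b i) x)) = indicator (\<Inter>i. T (\<gamma> *v (int k *s v i)) ` A) x"
          by (auto simp: indicator_def prod_zero_iff)
        then show ?thesis unfolding B_def f_def by (simp add: indicator_inter_arith)
      qed
      then have "(\<integral>x. f x * (\<Prod>i\<in>UNIV. f (S (int k *s b i) x)) \<partial>M) = (\<integral>x. indicator B x \<partial>M)"
        by (rule Bochner_Integration.integral_cong[OF refl])
      also have "\<dots> = measure M (B \<inter> space M)" by simp
      also have "B \<inter> space M = B" unfolding B_def using sets.sets_into_space[OF A] by blast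
      finally show ?thesis using pos \<gamma>(1) unfolding B_def by auto
    qed
    ultimately show "\<exists>k::nat. 1 \<le> k \<and> k \<le> L ^ R \<and>
          (\<forall>v :: 'd \<Rightarrow> int ^ 'd.
             0 < \<bar>det (column_matrix v)\<bar> \<longrightarrow> \<bar>det (column_matrix v)\<bar> \<le> int D \<longrightarrow>
             (\<exists>\<gamma> :: int ^ 'd ^ 'd. det \<gamma> = 1 \<and>
                measure M (A \<inter> (\<Inter>i. T (\<gamma> *v (int k *s v i)) ` A)) > 0))"
      by blast
  qed
  moreover have "0 < L ^ R" using L0 by simp
  ultimately show ?thesis by blast
qed

section \<open>The factor on configuration space\<close>

lemma norm_diff_square_le: "(norm (a - b))\<^sup>2 \<le> 2 * (norm a)\<^sup>2 + 2 * (norm b)\<^sup>2"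
  for a b :: "'b::real_normed_vector"
proof -
  have "(norm (a - b))\<^sup>2 \<le> (norm a + norm b)\<^sup>2"
    by (intro power_mono norm_triangle_ineq4) simp
  also have "\<dots> \<le> 2 * (norm a)\<^sup>2 + 2 * (norm b)\<^sup>2"
    using zero_le_power2[of "norm a - norm b"] by (simp add: power2_sum power2_diff)
  finally show ?thesis .
qed

lemma square_integrable_diff:
  assumes "square_integrable M f" "square_integrable M h"
  shows "integrable M (\<lambda>x. (norm (f x - h x))\<^sup>2)"
proof (rule Bochner_Integration.integrable_bound)
  show "integrable M (\<lambda>x. 2 * (norm (f x))\<^sup>2 + 2 * (norm (h x))\<^sup>2)"
    using assms unfolding square_integrable_def by auto
  have [measurable]: "f \<in> borel_measurable M" "h \<in> borel_measurable M"
    using assms unfolding square_integrable_def by auto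
  show "(\<lambda>x. (norm (f x - h x))\<^sup>2) \<in> borel_measurable M" by measurable
  show "AE x in M. norm ((norm (f x - h x))\<^sup>2) \<le> norm (2 * (norm (f x))\<^sup>2 + 2 * (norm (h x))\<^sup>2)"
    using norm_diff_square_le by (auto simp: abs_of_nonneg)
qed

text \<open>Composition with \<open>\<pi>\<close> embeds the square-integrable functions of \<open>N\<close> isometrically into those of \<open>M\<close>, and subsets of separable
  pseudometric spaces are separable: for each \<open>g\<close> of a countable dense family and each radius \<open>1 / (n + 1)\<close> pick, if there is one, a
  function of the factor that is so close to \<open>g\<close>.\<close>
lemma separable_L2_distr:
  assumes sep: "separable_L2 M" and \<pi>: "\<pi> \<in> measurable M N" and N: "N = distr M N \<pi>"
  shows "separable_L2 N"
proof -
  obtain S where S: "countable S" "\<And>g. g \<in> S \<Longrightarrow> square_integrable M g"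
    and dense: "\<And>f \<epsilon>. square_integrable M f \<Longrightarrow> 0 < \<epsilon> \<Longrightarrow>
      \<exists>g\<in>S. sqrt (\<integral>x. (norm (f x - g x))\<^sup>2 \<partial>M) < \<epsilon>"
    using sep unfolding separable_L2_def by metis
  have integral: "(\<integral>x. u x \<partial>N) = (\<integral>x. u (\<pi> x) \<partial>M)" if "u \<in> borel_measurable N" for u :: "'b \<Rightarrow> real"
    by (subst N) (rule integral_distr[OF \<pi> that])
  have pull: "square_integrable M (\<lambda>x. h (\<pi> x))" if "square_integrable N h" for h
  proof -
    have m[measurable]: "h \<in> borel_measurable N" using that unfolding square_integrable_def by blast
    have "integrable N (\<lambda>x. (norm (h x))\<^sup>2)" using that unfolding square_integrable_def by blast
    then have "integrable (distr M N \<pi>) (\<lambda>x. (norm (h x))\<^sup>2)" by (subst (asm) N)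
    then have "integrable M (\<lambda>x. (norm (h (\<pi> x)))\<^sup>2)"
      by (subst (asm) integrable_distr_eq[OF \<pi>]) measurable
    moreover have "(\<lambda>x. h (\<pi> x)) \<in> borel_measurable M" using measurable_compose[OF \<pi> m] .
    ultimately show ?thesis unfolding square_integrable_def by blast
  qed
  define near where "near g n h \<longleftrightarrow> square_integrable N h \<and>
      (\<integral>x. (norm (h (\<pi> x) - g x))\<^sup>2 \<partial>M) < (1 / real (Suc n))\<^sup>2" for g n h
  define pick where "pick = (\<lambda>(g, n). SOME h. near g n h)"
  define S' where "S' = pick ` {(g, n). g \<in> S \<and> (\<exists>h. near g n h)}"
  have pick: "near g n (pick (g, n))" if "near g n h" for g n h
    unfolding pick_def using someI[of "near g n", OF that] by simp
  have "countable (S \<times> (UNIV :: nat set))" using S(1) by simp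
  then have "countable {(g, n). g \<in> S \<and> (\<exists>h. near g n h)}" by (rule countable_subset[rotated]) auto
  then have "countable S'" unfolding S'_def by (rule countable_image)
  moreover have "\<forall>h\<in>S'. square_integrable N h"
    unfolding S'_def using pick near_def by auto
  moreover have "\<exists>h\<in>S'. sqrt (\<integral>x. (norm (f x - h x))\<^sup>2 \<partial>N) < \<epsilon>"
    if f: "square_integrable N f" and \<epsilon>: "0 < \<epsilon>" for f \<epsilon>
  proof -
    obtain n where n: "1 / real (Suc n) < \<epsilon> / 2"
      using reals_Archimedean[of "\<epsilon> / 2"] \<epsilon> by (auto simp: inverse_eq_divide)
    let ?r = "1 / real (Suc n)"
    obtain g where g: "g \<in> S" "sqrt (\<integral>x. (norm (f (\<pi> x) - g x))\<^sup>2 \<partial>M) < ?r"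
      using dense[OF pull[OF f], of ?r] by auto
    have f_g: "(\<integral>x. (norm (f (\<pi> x) - g x))\<^sup>2 \<partial>M) < ?r\<^sup>2"
    proof -
      have "sqrt (?r\<^sup>2) = ?r" by (rule real_sqrt_unique) auto
      with g(2) have "sqrt (\<integral>x. (norm (f (\<pi> x) - g x))\<^sup>2 \<partial>M) < sqrt (?r\<^sup>2)" by simp
      then show ?thesis by (simp only: real_sqrt_less_iff)
    qed
    then have "near g n f" unfolding near_def using f by blast
    define h where "h = pick (g, n)"
    have near: "near g n h" unfolding h_def using pick[OF \<open>near g n f\<close>] .
    have h: "square_integrable N h" using near unfolding near_def by blast
    have "h \<in> S'" unfolding S'_def h_def using g(1) \<open>near g n f\<close> by blast
    have i: "integrable M (\<lambda>x. (norm (f (\<pi> x) - g x))\<^sup>2)" "integrable M (\<lambda>x. (norm (h (\<pi> x) - g x))\<^sup>2)"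
      by (intro square_integrable_diff pull f h S(2) g(1))+
    have [measurable]: "f \<in> borel_measurable N" "h \<in> borel_measurable N"
      using f h unfolding square_integrable_def by auto
    have "(\<integral>x. (norm (f x - h x))\<^sup>2 \<partial>N) = (\<integral>x. (norm (f (\<pi> x) - h (\<pi> x)))\<^sup>2 \<partial>M)"
      by (rule integral) measurable
    also have "\<dots> \<le> (\<integral>x. 2 * (norm (f (\<pi> x) - g x))\<^sup>2 + 2 * (norm (h (\<pi> x) - g x))\<^sup>2 \<partial>M)"
    proof (rule integral_mono)
      show "integrable M (\<lambda>x. (norm (f (\<pi> x) - h (\<pi> x)))\<^sup>2)"
        by (intro square_integrable_diff pull f h)
      show "(norm (f (\<pi> x) - h (\<pi> x)))\<^sup>2 \<le> 2 * (norm (f (\<pi> x) - g x))\<^sup>2 + 2 * (norm (h (\<pi> x) - g x))\<^sup>2" for x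
        using norm_diff_square_le[of "f (\<pi> x) - g x" "h (\<pi> x) - g x"] by simp
    qed (use i in auto)
    also have "\<dots> = 2 * (\<integral>x. (norm (f (\<pi> x) - g x))\<^sup>2 \<partial>M) + 2 * (\<integral>x. (norm (h (\<pi> x) - g x))\<^sup>2 \<partial>M)"
      using i by simp
    also have "\<dots> < 4 * ?r\<^sup>2" using f_g near unfolding near_def by linarith
    also have "4 * ?r\<^sup>2 = (2 * ?r)\<^sup>2" by (simp only: power_mult_distrib) simp
    also have "\<dots> \<le> \<epsilon>\<^sup>2" using n by (intro power_mono) auto
    finally have "sqrt (\<integral>x. (norm (f x - h x))\<^sup>2 \<partial>N) < \<epsilon>"
      using \<epsilon> by (intro real_less_lsqrt) auto
    then show ?thesis using \<open>h \<in> S'\<close> by blast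
  qed
  ultimately show ?thesis unfolding separable_L2_def by blast
qed

locale itinerary_factor = ergodic_pmp_action M T
  for M :: "'a measure" and T :: "int ^ 'd::finite \<Rightarrow> 'a \<Rightarrow> 'a" +
  fixes A :: "'a set"
  assumes A: "A \<in> sets M"
begin

definition itinerary :: "'a \<Rightarrow> int ^ 'd \<Rightarrow> bool" where
  "itinerary x = (\<lambda>v. T v x \<in> A)"

definition shift :: "int ^ 'd \<Rightarrow> (int ^ 'd \<Rightarrow> bool) \<Rightarrow> int ^ 'd \<Rightarrow> bool" where
  "shift w \<omega> = (\<lambda>v. \<omega> (v + w))"

text \<open>The largest \<open>\<sigma>\<close>-algebra for which the itinerary is measurable. It contains the product \<open>\<sigma>\<close>-algebra, and with it
  measurability in the factor is by definition measurability upstairs.\<close>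
definition factor_sets :: "(int ^ 'd \<Rightarrow> bool) set set" where
  "factor_sets = {B. itinerary -` B \<inter> space M \<in> sets M}"

definition factor :: "(int ^ 'd \<Rightarrow> bool) measure" where
  "factor = distr M (sigma UNIV factor_sets) itinerary"

lemma sigma_algebra_factor_sets: "sigma_algebra UNIV factor_sets"
proof (rule sigma_algebra_iff2[THEN iffD2], intro conjI ballI allI impI)
  show "factor_sets \<subseteq> Pow UNIV" by simp
  show "{} \<in> factor_sets" by (simp add: factor_sets_def)
  show "UNIV - B \<in> factor_sets" if "B \<in> factor_sets" for B
  proof -
    have "itinerary -` (UNIV - B) \<inter> space M = space M - (itinerary -` B \<inter> space M)" by auto
    then show ?thesis using that unfolding factor_sets_def by auto
  qed
  show "(\<Union>i. B i) \<in> factor_sets" if "range B \<subseteq> factor_sets" for B :: "nat \<Rightarrow> _"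
  proof -
    have "itinerary -` (\<Union>i. B i) \<inter> space M = (\<Union>i. itinerary -` B i \<inter> space M)" by auto
    moreover have "(\<Union>i. itinerary -` B i \<inter> space M) \<in> sets M"
      using that unfolding factor_sets_def by (intro sets.countable_UN) auto
    ultimately show ?thesis unfolding factor_sets_def by (simp only: mem_Collect_eq)
  qed
qed

lemma sets_factor: "sets factor = factor_sets"
  unfolding factor_def using sigma_algebra.sets_measure_of_eq[OF sigma_algebra_factor_sets] by simp

lemma space_factor: "space factor = UNIV"
  unfolding factor_def by (simp add: space_measure_of_conv)

lemma itinerary_measurable: "itinerary \<in> measurable M factor"
  by (rule measurableI) (auto simp: space_factor sets_factor factor_sets_def)

lemma factor_eq: "factor = distr M factor itinerary"
proof -
  have "sets (sigma UNIV factor_sets) = sets factor" unfolding factor_def by simp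
  then show ?thesis using distr_cong[of M M "sigma UNIV factor_sets" factor itinerary itinerary]
    by (simp add: factor_def[symmetric])
qed

lemma measure_factor: "B \<in> factor_sets \<Longrightarrow> measure factor B = measure M (itinerary -` B \<inter> space M)"
  using measure_distr[OF itinerary_measurable] factor_eq sets_factor by metis

lemma itinerary_shift: "x \<in> space M \<Longrightarrow> itinerary (T w x) = shift w (itinerary x)"
  unfolding itinerary_def shift_def by (simp add: action_add)

lemma shift_preimage:
  "itinerary -` (shift w -` B) \<inter> space M = T w -` (itinerary -` B \<inter> space M) \<inter> space M"
  using itinerary_shift action_space by auto

lemma shift_measurable: "shift w \<in> measurable factor factor"
proof (rule measurableI)
  fix B assume "B \<in> sets factor"
  then have "itinerary -` B \<inter> space M \<in> sets M" by (simp add: sets_factor factor_sets_def)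
  then have "T w -` (itinerary -` B \<inter> space M) \<inter> space M \<in> sets M"
    using action_measurable measurable_sets by blast
  then show "shift w -` B \<inter> space factor \<in> sets factor"
    by (simp add: space_factor sets_factor factor_sets_def shift_preimage)
qed (simp add: space_factor)

text \<open>The itinerary intertwines \<open>T\<close> with the shift, so shift-invariant sets pull back to \<open>T\<close>-invariant sets of the same measure.\<close>
lemma ergodic_factor: "ergodic_pmp_action factor shift"
proof (intro ergodic_pmp_action.intro pmp_action.intro pmp_action_axioms.intro
    ergodic_pmp_action_axioms.intro)
  show p: "prob_space factor"
    using prob_space_distr[OF itinerary_measurable] factor_eq by simp
  show "shift 0 \<omega> = \<omega>" for \<omega> by (simp add: shift_def)
  show "shift (u + v) \<omega> = shift u (shift v \<omega>)" for u v \<omega> by (simp add: shift_def add.assoc)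
  show "shift w \<in> measurable factor factor" for w by (rule shift_measurable)
  show "distr factor factor (shift w) = factor" for w
  proof -
    have "distr factor factor (shift w) = distr M factor (shift w \<circ> itinerary)"
      using distr_distr[OF shift_measurable itinerary_measurable] factor_eq by metis
    also have "\<dots> = distr M factor (itinerary \<circ> T w)"
      by (rule distr_cong) (simp_all add: itinerary_shift)
    also have "\<dots> = distr (distr M M (T w)) factor itinerary"
      by (rule distr_distr[OF itinerary_measurable action_measurable, symmetric])
    also have "\<dots> = factor" using factor_eq by (simp add: action_preserving)
    finally show ?thesis .
  qed
  show "measure factor B = 0 \<or> measure factor B = 1"
    if B: "B \<in> sets factor" and inv: "\<And>v. shift v -` B \<inter> space factor = B" for B
  proof -
    let ?C = "itinerary -` B \<inter> space M"
    have "?C \<in> sets M" using B by (simp add: sets_factor factor_sets_def)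
    moreover have "T v -` ?C \<inter> space M = ?C" for v
    proof -
      have "shift v -` B = B" using inv[of v] by (simp add: space_factor)
      then show ?thesis using shift_preimage[of v B] by (simp only:)
    qed
    ultimately have "prob ?C = 0 \<or> prob ?C = 1" by (rule ergodic)
    then show ?thesis using measure_factor B by (simp add: sets_factor)
  qed
qed

lemma separable_factor: "separable_L2 M \<Longrightarrow> separable_L2 factor"
  using separable_L2_distr itinerary_measurable factor_eq by blast

abbreviation "cylinder \<equiv> {\<omega> :: int ^ 'd \<Rightarrow> bool. \<omega> 0}"

text \<open>The shifted cylinders represent the images of \<open>A\<close>: \<open>x\<close> lies in \<open>T w ` A\<close> iff \<open>T (- w) x\<close> lies in \<open>A\<close>.\<close>
lemma cylinder_preimage: "itinerary -` (shift w ` cylinder) \<inter> space M = T w ` A"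
proof -
  have "shift w ` cylinder = {\<omega>. \<omega> (- w)}"
  proof
    show "{\<omega>. \<omega> (- w)} \<subseteq> shift w ` cylinder"
    proof
      fix \<omega> :: "int ^ 'd \<Rightarrow> bool" assume "\<omega> \<in> {\<omega>. \<omega> (- w)}"
      then have "shift (- w) \<omega> \<in> cylinder" "\<omega> = shift w (shift (- w) \<omega>)" by (simp_all add: shift_def)
      then show "\<omega> \<in> shift w ` cylinder" by blast
    qed
  qed (auto simp: shift_def)
  then show ?thesis unfolding action_image[OF A] by (auto simp: itinerary_def)
qed

lemma cylinder_preimage_zero: "itinerary -` cylinder \<inter> space M = A"
  using sets.sets_into_space[OF A] action_zero by (auto simp: itinerary_def)

lemma measure_factor_intersection:
  "measure factor (cylinder \<inter> (\<Inter>i. shift (w i) ` cylinder)) = measure M (A \<inter> (\<Inter>i. T (w i) ` A))"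
  for w :: "'d \<Rightarrow> int ^ 'd"
proof -
  let ?B = "cylinder \<inter> (\<Inter>i. shift (w i) ` cylinder)"
  have pre: "itinerary -` ?B \<inter> space M = A \<inter> (\<Inter>i. T (w i) ` A)"
  proof -
    have "itinerary -` ?B \<inter> space M = (itinerary -` cylinder \<inter> space M) \<inter>
        (\<Inter>i. itinerary -` (shift (w i) ` cylinder) \<inter> space M)" by blast
    then show ?thesis by (simp only: cylinder_preimage cylinder_preimage_zero)
  qed
  have "A \<inter> (\<Inter>i. T (w i) ` A) \<in> sets M"
    using A action_image_sets[OF A] by (intro sets.Int sets.finite_INT) auto
  then have "?B \<in> factor_sets" unfolding factor_sets_def using pre by simp
  then show ?thesis using measure_factor pre by simp
qed

lemma measure_cylinder: "measure factor cylinder = measure M A"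
proof -
  have "cylinder \<in> factor_sets" unfolding factor_sets_def using cylinder_preimage_zero A by simp
  then show ?thesis using measure_factor cylinder_preimage_zero by simp
qed

lemma cylinder_sets: "cylinder \<in> sets factor"
  unfolding sets_factor factor_sets_def using cylinder_preimage_zero A by simp

end

lemma recurrence_bound_transfer:
  assumes "recurrence_bound TYPE(int ^ 'd \<Rightarrow> bool) TYPE('d::finite) D \<delta> K"
  shows "recurrence_bound TYPE('a) TYPE('d) D \<delta> K"
  unfolding recurrence_bound_def
proof (intro allI impI)
  fix M :: "'a measure" and T :: "int ^ 'd \<Rightarrow> 'a \<Rightarrow> 'a" and A
  assume erg: "ergodic_pmp_action M T" and sep: "separable_L2 M" and A: "A \<in> sets M"
    and \<delta>: "\<delta> \<le> measure M A"
  interpret itinerary_factor M T A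
    using erg A by (simp add: itinerary_factor_def itinerary_factor_axioms_def)
  show "\<exists>k::nat. 1 \<le> k \<and> k \<le> K \<and>
      (\<forall>v :: 'd \<Rightarrow> int ^ 'd.
         0 < \<bar>det (column_matrix v)\<bar> \<longrightarrow> \<bar>det (column_matrix v)\<bar> \<le> int D \<longrightarrow>
         (\<exists>\<gamma> :: int ^ 'd ^ 'd. det \<gamma> = 1 \<and>
            measure M (A \<inter> (\<Inter>i. T (\<gamma> *v (int k *s v i)) ` A)) > 0))"
    using assms[unfolded recurrence_bound_def, rule_format, OF ergodic_factor separable_factor[OF sep]
        cylinder_sets] \<delta>
    by (simp only: measure_factor_intersection measure_cylinder)
qed

section \<open>The recurrence theorem\<close>

theorem theorem1p3:
  fixes D :: nat and \<delta> :: real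
  assumes "CARD('d::finite) \<ge> 2" and "D > 0" and "\<delta> > 0"
  shows "0 < k0 TYPE('d) D \<delta> \<and>
    (\<forall>(M :: 'a measure) (T :: int ^ 'd \<Rightarrow> 'a \<Rightarrow> 'a) A.
        ergodic_pmp_action M T \<longrightarrow> separable_L2 M \<longrightarrow> A \<in> sets M \<longrightarrow> \<delta> \<le> measure M A \<longrightarrow>
        (\<exists>k::nat. 1 \<le> k \<and> k \<le> k0 TYPE('d) D \<delta> \<and>
          (\<forall>v :: 'd \<Rightarrow> int ^ 'd.
             0 < \<bar>det (column_matrix v)\<bar> \<longrightarrow> \<bar>det (column_matrix v)\<bar> \<le> int D \<longrightarrow>
             (\<exists>\<gamma> :: int ^ 'd ^ 'd. det \<gamma> = 1 \<and>
                measure M (A \<inter> (\<Inter>i. T (\<gamma> *v (int k *s v i)) ` A)) > 0))))"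
proof -
  obtain K where K: "0 < K" "recurrence_bound TYPE(int ^ 'd \<Rightarrow> bool) TYPE('d) D \<delta> K"
    using recurrence_bound_exists[OF assms(1,3)] by blast
  then have "0 < k0 TYPE('d) D \<delta> \<and>
      recurrence_bound TYPE(int ^ 'd \<Rightarrow> bool) TYPE('d) D \<delta> (k0 TYPE('d) D \<delta>)"
    unfolding k0_def
    by (intro LeastI[where P = "\<lambda>K. 0 < K \<and> recurrence_bound TYPE(int ^ 'd \<Rightarrow> bool) TYPE('d) D \<delta> K"] conjI)
  then have "0 < k0 TYPE('d) D \<delta>" "recurrence_bound TYPE('a) TYPE('d) D \<delta> (k0 TYPE('d) D \<delta>)"
    by (simp_all add: recurrence_bound_transfer)
  then show ?thesis unfolding recurrence_bound_def by blast
qed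

end
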